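(* If a network with configuration $\chi=\{(M_1,N_1,d_1),\dots,(M_K,N_K,d_K)\}$ is IA feasible, then for every positive integer $c$ the network with configuration $\chi^c=\{(cM_1,cN_1,cd_1),\dots,(cM_K,cN_K,cd_K)\}$ is IA feasible.
   Context: A MIMO interference network with configuration $\{(M_1,N_1,d_1),\dots,(M_K,N_K,d_K)\}$ has $K$ transmitter-receiver pairs; transmitter $k$ has $M_k$ antennas, receiver $k$ has $N_k$ antennas, and $d_k$ data streams are sent from transmitter $k$ to receiver $k$ ($M_k,N_k,d_k$ positive integers). The channel matrices are $\mathbf{H}_{kj}\in\mathbb{C}^{N_k\times M_j}$, $k,j\in\{1,\dots,K\}$; the entries of all the channel matrices are independent random variables drawn from continuous distributions. IA problem: given $\{\mathbf{H}_{kj}\}$, find $\mathbf{U}_k\in\mathbb{C}^{N_k\times d_k}$ and $\mathbf{V}_k\in\mathbb{C}^{M_k\times d_k}$, $k\in\{1,\dots,K\}$, such that $\mathrm{rank}(\mathbf{U}_k^H\mathbf{H}_{kk}\mathbf{V}_k)=d_k$ for all $k$, and $\mathbf{U}_k^H\mathbf{H}_{kj}\mathbf{V}_j=\mathbf{0}$ for all $k\ne j$. Here $(\cdot)^H$ is the Hermitian transpose. A network is called IA feasible if the IA problem has a solution almost surely with respect to its channel matrices. *)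

theory Defs
  imports
    "HOL-Probability.Probability"
    "Jordan_Normal_Form.Schur_Decomposition"
    "Jordan_Normal_Form.DL_Rank"
begin

text \<open>
  A configuration is given by the number of users \<open>K\<close> and the functions \<open>M\<close>, \<open>N\<close>, \<open>d\<close>, of which
  only the values on \<open>{1..K}\<close> matter.
\<close>

definition configuration ::
    "nat \<Rightarrow> (nat \<Rightarrow> nat) \<Rightarrow> (nat \<Rightarrow> nat) \<Rightarrow> (nat \<Rightarrow> nat) \<Rightarrow> bool" where
  "configuration K M N d \<longleftrightarrow> 0 < K \<and> (\<forall>k\<in>{1..K}. 0 < M k \<and> 0 < N k \<and> 0 < d k)"

text \<open>Matrix positions are 0-based, users are numbered from 1.\<close>

definition channel_entries ::
    "nat \<Rightarrow> (nat \<Rightarrow> nat) \<Rightarrow> (nat \<Rightarrow> nat) \<Rightarrow> (nat \<times> nat \<times> nat \<times> nat) set" where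
  "channel_entries K M N = {(k, j, a, b). k \<in> {1..K} \<and> j \<in> {1..K} \<and> a < N k \<and> b < M j}"

text \<open>
  A network is a configuration together with its random channel matrices. A continuous
  distribution is one that has a density with respect to Lebesgue measure on the complex plane;
  the densities of different entries may differ.
\<close>

locale mimo_network = prob_space P
  for P :: "'w measure" +
  fixes K :: nat and M N d :: "nat \<Rightarrow> nat"
    and H :: "nat \<Rightarrow> nat \<Rightarrow> 'w \<Rightarrow> complex mat"
  assumes config: "configuration K M N d"
    and channel_dim:
      "\<And>k j \<omega>. k \<in> {1..K} \<Longrightarrow> j \<in> {1..K} \<Longrightarrow> \<omega> \<in> space P \<Longrightarrow> H k j \<omega> \<in> carrier_mat (N k) (M j)"
    and channel_indep:
      "indep_vars (\<lambda>_. borel) (\<lambda>(k, j, a, b) \<omega>. H k j \<omega> $$ (a, b)) (channel_entries K M N)"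
    and channel_continuous:
      "\<And>k j a b. (k, j, a, b) \<in> channel_entries K M N \<Longrightarrow>
         \<exists>f. distributed P lborel (\<lambda>\<omega>. H k j \<omega> $$ (a, b)) f"

definition ia_solution ::
    "nat \<Rightarrow> (nat \<Rightarrow> nat) \<Rightarrow> (nat \<Rightarrow> nat) \<Rightarrow> (nat \<Rightarrow> nat) \<Rightarrow> (nat \<Rightarrow> nat \<Rightarrow> complex mat) \<Rightarrow>
     (nat \<Rightarrow> complex mat) \<Rightarrow> (nat \<Rightarrow> complex mat) \<Rightarrow> bool" where
  "ia_solution K M N d H U V \<longleftrightarrow>
     (\<forall>k\<in>{1..K}. U k \<in> carrier_mat (N k) (d k) \<and> V k \<in> carrier_mat (M k) (d k)) \<and>
     (\<forall>k\<in>{1..K}. vec_space.rank (d k) (mat_adjoint (U k) * H k k * V k) = d k) \<and>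
     (\<forall>k\<in>{1..K}. \<forall>j\<in>{1..K}. k \<noteq> j \<longrightarrow>
        mat_adjoint (U k) * H k j * V j = 0\<^sub>m (d k) (d j))"

definition ia_feasible ::
    "'w measure \<Rightarrow> nat \<Rightarrow> (nat \<Rightarrow> nat) \<Rightarrow> (nat \<Rightarrow> nat) \<Rightarrow> (nat \<Rightarrow> nat) \<Rightarrow>
     (nat \<Rightarrow> nat \<Rightarrow> 'w \<Rightarrow> complex mat) \<Rightarrow> bool" where
  "ia_feasible P K M N d H \<longleftrightarrow>
     (AE \<omega> in P. \<exists>U V. ia_solution K M N d (\<lambda>k j. H k j \<omega>) U V)"

end

theory Submission imports Defs begin

hide_const (open) Module.smult

text \<open>
  Inverting \<open>U\<^sub>k\<^sup>H H\<^sub>k\<^sub>k V\<^sub>k\<close> turns interference alignment into one matrix equation \<open>A H V = I\<close>, where \<open>H\<close>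
  collects all channels and \<open>A\<close>, \<open>V\<close> are block diagonal. Almost surely the entries of \<open>H\<close> are
  algebraically independent over the rationals.

  If \<open>A H V = I\<close> for such an \<open>H\<close>, then for every \<open>E\<close> there is a derivation of the complex numbers
  with \<open>D H = E\<close>, and \<open>(D A) H V + A E V + A H (D V) = 0\<close>; as \<open>A E V\<close> is arbitrary, the derivative
  of \<open>(A, V) \<mapsto> A H V\<close> at the solution is surjective. Surjectivity survives the passage to \<open>c\<close> diagonal
  copies \<open>H\<^sub>0\<close>, \<open>A\<^sub>0\<close>, \<open>V\<^sub>0\<close>, since the derivative decouples into blocks.

  For an algebraically independent \<open>H'\<close> of the large format, Hensel lifting gives power series
  solutions \<open>A(t)\<close>, \<open>V(t)\<close> for \<open>H\<^sub>0 + t (H' - H\<^sub>0)\<close>. Setting \<open>t = 1\<close> is an injective homomorphism from the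
  ring generated by the entries of this line to the complex numbers; it extends to the entries of
  \<open>A(t)\<close> and \<open>V(t)\<close> because the complex numbers are algebraically closed, and thus yields a solution
  for \<open>H'\<close>.
\<close>

section \<open>Extending homomorphisms to ring extensions\<close>

definition is_subring :: "'a::comm_ring_1 set \<Rightarrow> bool" where
  "is_subring S \<longleftrightarrow> 1 \<in> S \<and> (\<forall>x\<in>S. \<forall>y\<in>S. x - y \<in> S \<and> x * y \<in> S)"

text \<open>The homomorphism is a total function of which only the values on \<open>S\<close> count,
  so that extending it to a larger subring means agreeing with it on \<open>S\<close>.\<close>

definition ring_hom_on :: "'a::comm_ring_1 set \<Rightarrow> ('a \<Rightarrow> 'b::comm_ring_1) \<Rightarrow> bool" where
  "ring_hom_on S \<phi> \<longleftrightarrow> \<phi> 1 = 1 \<and> (\<forall>x\<in>S. \<forall>y\<in>S. \<phi> (x + y) = \<phi> x + \<phi> y \<and> \<phi> (x * y) = \<phi> x * \<phi> y)"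

definition polys_over :: "'a::comm_ring_1 set \<Rightarrow> 'a poly set" where
  "polys_over S = {p. \<forall>n. coeff p n \<in> S}"

definition adjoin :: "'a::comm_ring_1 set \<Rightarrow> 'a \<Rightarrow> 'a set" where
  "adjoin S x = (\<lambda>p. poly p x) ` polys_over S"

lemma map_poly_const: "f 0 = 0 \<Longrightarrow> map_poly f [:c:] = [:f c:]"
  by (intro poly_eqI) (simp add: coeff_map_poly coeff_pCons split: nat.split)

context
  fixes S :: "'a::comm_ring_1 set"
  assumes S: "is_subring S"
begin

lemma subring_one: "1 \<in> S" using S by (auto simp: is_subring_def)

lemma subring_diff: "x \<in> S \<Longrightarrow> y \<in> S \<Longrightarrow> x - y \<in> S" using S by (auto simp: is_subring_def)

lemma subring_mult: "x \<in> S \<Longrightarrow> y \<in> S \<Longrightarrow> x * y \<in> S" using S by (auto simp: is_subring_def)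

lemma subring_zero: "0 \<in> S" using subring_diff[OF subring_one subring_one] by simp

lemma subring_uminus: "x \<in> S \<Longrightarrow> - x \<in> S" using subring_diff[OF subring_zero] by fastforce

lemma subring_add: "x \<in> S \<Longrightarrow> y \<in> S \<Longrightarrow> x + y \<in> S"
  using subring_diff[OF _ subring_uminus] by fastforce

lemma subring_sum: "(\<And>i. i \<in> I \<Longrightarrow> f i \<in> S) \<Longrightarrow> sum f I \<in> S"
  by (induction I rule: infinite_finite_induct) (auto intro: subring_add subring_zero)

lemma subring_power: "x \<in> S \<Longrightarrow> x ^ n \<in> S"
  by (induction n) (auto intro: subring_one subring_mult)

lemma is_subring_polys_over: "is_subring (polys_over S)"
  by (auto simp: is_subring_def polys_over_def coeff_mult
      intro!: subring_one subring_zero subring_diff subring_sum subring_mult simp: coeff_1)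

lemma polys_over_pCons: "a \<in> S \<Longrightarrow> p \<in> polys_over S \<Longrightarrow> pCons a p \<in> polys_over S"
  by (auto simp: polys_over_def coeff_pCons split: nat.split)

lemma polys_over_zero: "0 \<in> polys_over S"
  by (auto simp: polys_over_def subring_zero)

lemma polys_over_monom: "a \<in> S \<Longrightarrow> monom a n \<in> polys_over S"
  by (auto simp: polys_over_def coeff_monom subring_zero)

lemma polys_over_smult: "a \<in> S \<Longrightarrow> p \<in> polys_over S \<Longrightarrow> smult a p \<in> polys_over S"
  by (auto simp: polys_over_def subring_mult)

lemma polys_over_lead_coeff: "p \<in> polys_over S \<Longrightarrow> lead_coeff p \<in> S"
  by (auto simp: polys_over_def)

lemma is_subring_adjoin: "is_subring (adjoin S x)"
  unfolding is_subring_def adjoin_def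
proof (intro conjI ballI)
  show "1 \<in> (\<lambda>p. poly p x) ` polys_over S"
    using is_subring_polys_over by (auto simp: is_subring_def intro!: image_eqI[of _ _ 1])
  fix u v assume "u \<in> (\<lambda>p. poly p x) ` polys_over S" "v \<in> (\<lambda>p. poly p x) ` polys_over S"
  then obtain p q where "p \<in> polys_over S" "q \<in> polys_over S" "u = poly p x" "v = poly q x" by auto
  then show "u - v \<in> (\<lambda>p. poly p x) ` polys_over S" "u * v \<in> (\<lambda>p. poly p x) ` polys_over S"
    using is_subring_polys_over image_eqI[of "u - v" "\<lambda>p. poly p x" "p - q"]
      image_eqI[of "u * v" "\<lambda>p. poly p x" "p * q"]
    by (auto simp: is_subring_def)
qed

lemma subset_adjoin: "S \<subseteq> adjoin S x"
  by (auto simp: adjoin_def intro!: image_eqI[of _ _ "[:_:]"] polys_over_pCons polys_over_zero)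

lemma mem_adjoin: "x \<in> adjoin S x"
  by (auto simp: adjoin_def intro!: image_eqI[of _ _ "[:0, 1:]"] polys_over_pCons polys_over_zero
      subring_zero subring_one)

lemma ring_hom_on_zero: "ring_hom_on S \<phi> \<Longrightarrow> \<phi> 0 = 0"
  using subring_zero unfolding ring_hom_on_def by (metis add_cancel_right_right)

lemma ring_hom_on_sum:
  assumes "ring_hom_on S \<phi>" "\<And>i. i \<in> I \<Longrightarrow> f i \<in> S"
  shows "\<phi> (sum f I) = (\<Sum>i\<in>I. \<phi> (f i))"
  using assms(2)
proof (induction I rule: infinite_finite_induct)
  case (insert i I)
  then show ?case using assms(1) subring_sum[of I f] by (simp add: ring_hom_on_def)
qed (use ring_hom_on_zero[OF assms(1)] in auto)

lemma ring_hom_on_map_poly: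
  assumes "ring_hom_on S \<phi>"
  shows "ring_hom_on (polys_over S) (map_poly \<phi>)"
proof -
  note \<phi>0 = ring_hom_on_zero[OF assms]
  have "map_poly \<phi> (p * q) = map_poly \<phi> p * map_poly \<phi> q"
    if "p \<in> polys_over S" "q \<in> polys_over S" for p q
  proof (rule poly_eqI)
    fix n
    have "\<phi> (\<Sum>i\<le>n. coeff p i * coeff q (n - i)) = (\<Sum>i\<le>n. \<phi> (coeff p i * coeff q (n - i)))"
      by (rule ring_hom_on_sum[OF assms]) (use that in \<open>auto simp: polys_over_def intro: subring_mult\<close>)
    then show "coeff (map_poly \<phi> (p * q)) n = coeff (map_poly \<phi> p * map_poly \<phi> q) n"
      using assms that by (simp add: coeff_map_poly \<phi>0 coeff_mult ring_hom_on_def polys_over_def)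
  qed
  moreover have "map_poly \<phi> (p + q) = map_poly \<phi> p + map_poly \<phi> q"
    if "p \<in> polys_over S" "q \<in> polys_over S" for p q
    using assms that by (intro poly_eqI) (simp add: coeff_map_poly \<phi>0 ring_hom_on_def polys_over_def)
  ultimately show ?thesis using assms by (simp add: ring_hom_on_def)
qed

lemma ring_hom_on_power:
  assumes "ring_hom_on S \<phi>" "x \<in> S" shows "\<phi> (x ^ n) = \<phi> x ^ n"
  using assms subring_power[OF assms(2)] by (induction n) (auto simp: ring_hom_on_def)

text \<open>Two polynomial expressions of the same element differ by a relation of \<open>x\<close>,
  and \<open>ker\<close> sends relations of \<open>x\<close> to relations of \<open>y\<close>; hence
  \<open>x \<mapsto> y\<close> is well defined.\<close>

lemma extend_ring_hom_on:
  assumes \<phi>: "ring_hom_on S \<phi>"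
    and ker: "\<And>p. p \<in> polys_over S \<Longrightarrow> poly p x = 0 \<Longrightarrow> poly (map_poly \<phi> p) y = 0"
  obtains \<phi>' where "ring_hom_on (adjoin S x) \<phi>'" "\<And>s. s \<in> S \<Longrightarrow> \<phi>' s = \<phi> s"
    "\<And>p. p \<in> polys_over S \<Longrightarrow> \<phi>' (poly p x) = poly (map_poly \<phi> p) y"
proof -
  define \<phi>' where "\<phi>' v = poly (map_poly \<phi> (SOME p. p \<in> polys_over S \<and> poly p x = v)) y" for v
  note m = ring_hom_on_map_poly[OF \<phi>]
  have ev: "\<phi>' (poly p x) = poly (map_poly \<phi> p) y" if p: "p \<in> polys_over S" for p
  proof -
    define q where "q = (SOME q. q \<in> polys_over S \<and> poly q x = poly p x)"
    have q: "q \<in> polys_over S \<and> poly q x = poly p x" unfolding q_def by (rule someI[of _ p]) (use p in auto)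
    have "p - q \<in> polys_over S" using p q is_subring_polys_over by (auto simp: is_subring_def)
    then have "poly (map_poly \<phi> (p - q)) y = 0" using q by (intro ker) auto
    moreover have "map_poly \<phi> (p - q + q) = map_poly \<phi> (p - q) + map_poly \<phi> q"
      using m \<open>p - q \<in> _\<close> q unfolding ring_hom_on_def by blast
    ultimately show ?thesis by (simp add: \<phi>'_def q_def)
  qed
  show ?thesis
  proof
    show "\<phi>' (poly p x) = poly (map_poly \<phi> p) y" if "p \<in> polys_over S" for p using ev[OF that] .
    show "\<phi>' s = \<phi> s" if "s \<in> S" for s
      using ev[of "[:s:]"] that ring_hom_on_zero[OF \<phi>]
      by (simp add: polys_over_pCons polys_over_zero map_poly_const)
    show "ring_hom_on (adjoin S x) \<phi>'"
      unfolding ring_hom_on_def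
    proof (intro conjI ballI)
      have "\<phi>' (poly [:1:] x) = poly (map_poly \<phi> [:1:]) y"
        by (rule ev) (simp add: polys_over_pCons polys_over_zero subring_one)
      then show "\<phi>' 1 = 1" using \<phi> ring_hom_on_zero[OF \<phi>] by (simp add: ring_hom_on_def map_poly_const)
      fix u v assume "u \<in> adjoin S x" "v \<in> adjoin S x"
      then obtain p q where pq: "p \<in> polys_over S" "q \<in> polys_over S" "u = poly p x" "v = poly q x"
        unfolding adjoin_def by blast
      have "p + q \<in> polys_over S" "p * q \<in> polys_over S"
        using pq by (auto simp: polys_over_def coeff_mult intro!: subring_add subring_sum subring_mult)
      then show "\<phi>' (u + v) = \<phi>' u + \<phi>' v" "\<phi>' (u * v) = \<phi>' u * \<phi>' v"
        using ev[of "p + q"] ev[of "p * q"] ev[of p] ev[of q] pq m by (auto simp: ring_hom_on_def)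
    qed
  qed
qed

end

section \<open>Pseudo-division and relations of least degree\<close>

lemma pseudo_division:
  fixes S :: "'a::idom set"
  assumes S: "is_subring S" and m: "m \<in> polys_over S" "m \<noteq> 0" and p: "p \<in> polys_over S"
  obtains k q r where "q \<in> polys_over S" "r \<in> polys_over S"
    "smult (lead_coeff m ^ k) p = q * m + r" "r = 0 \<or> degree r < degree m"
proof -
  have "\<exists>k q r. q \<in> polys_over S \<and> r \<in> polys_over S \<and>
    smult (lead_coeff m ^ k) p = q * m + r \<and> (r = 0 \<or> degree r < degree m)"
    using p
  proof (induction "degree p" arbitrary: p rule: less_induct)
    case less
    note [simp] = m(2)
    have PS: "is_subring (polys_over S)" by (rule is_subring_polys_over[OF S])
    let ?c = "lead_coeff m"
    show ?case
    proof (cases "p = 0 \<or> degree p < degree m")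
      case True
      then show ?thesis using less.prems subring_zero[OF PS]
        by (intro exI[of _ 0] exI[of _ 0] exI[of _ p]) auto
    next
      case False
      then have p0: "p \<noteq> 0" and deg: "degree m \<le> degree p" by auto
      define n where "n = degree p - degree m"
      define t where "t = monom (lead_coeff p) n"
      have t: "t \<in> polys_over S" unfolding t_def
        by (intro polys_over_monom[OF S] polys_over_lead_coeff[OF S] less.prems)
      \<comment> \<open>Over a ring the leading coefficient of \<open>m\<close> may have no inverse,
        so \<open>p\<close> is scaled by it before its leading term is cancelled; each round adds
        one to the exponent \<open>k\<close>.\<close>
      define p' where "p' = smult ?c p - t * m"
      have p': "p' \<in> polys_over S" unfolding p'_def
        by (intro subring_diff[OF PS] polys_over_smult[OF S] subring_mult[OF PS] polys_over_lead_coeff[OF S] less.prems m t)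
      have dt: "degree (t * m) = degree p" using p0 deg
        by (simp add: t_def degree_mult_eq degree_monom_eq monom_eq_0_iff n_def)
      have "coeff p' (degree p) = 0"
        using lead_coeff_mult[of t m] dt p0 by (simp add: p'_def t_def degree_monom_eq mult.commute)
      moreover have "degree p' \<le> degree p" unfolding p'_def
        by (rule degree_diff_le) (use dt in auto)
      ultimately have "p' = 0 \<or> degree p' < degree p"
        by (metis leading_coeff_0_iff le_neq_implies_less)
      then have "\<exists>k q r. q \<in> polys_over S \<and> r \<in> polys_over S \<and>
        smult (?c ^ k) p' = q * m + r \<and> (r = 0 \<or> degree r < degree m)"
      proof
        assume "p' = 0"
        then show ?thesis using subring_zero[OF PS]
          by (intro exI[of _ 0] exI[of _ 0] exI[of _ 0]) auto
      qed (use less.hyps p' in blast)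
      then obtain k q r where kqr: "q \<in> polys_over S" "r \<in> polys_over S"
        "smult (?c ^ k) p' = q * m + r" "r = 0 \<or> degree r < degree m" by blast
      have "smult (?c ^ Suc k) p = smult (?c ^ k) (p' + t * m)" by (simp add: p'_def mult.commute)
      also have "\<dots> = (q + smult (?c ^ k) t) * m + r"
        unfolding smult_add_right kqr(3) by (simp add: algebra_simps)
      finally show ?thesis using kqr t
        by (intro exI[of _ "Suc k"] exI[of _ "q + smult (?c ^ k) t"] exI[of _ r])
          (auto intro!: subring_add[OF PS] polys_over_smult[OF S] subring_power[OF S] polys_over_lead_coeff[OF S] m)
    qed
  qed
  then show ?thesis using that by blast
qed

text \<open>A nonzero annihilating polynomial of least degree plays the role of the minimal polynomial;
  since \<open>S\<close> is only a ring, its leading coefficient need not be invertible.\<close>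

definition least_relation :: "'a::idom set \<Rightarrow> 'a \<Rightarrow> 'a poly \<Rightarrow> bool" where
  "least_relation S x m \<longleftrightarrow> m \<in> polys_over S \<and> m \<noteq> 0 \<and> poly m x = 0 \<and>
     (\<forall>p\<in>polys_over S. p \<noteq> 0 \<longrightarrow> poly p x = 0 \<longrightarrow> degree m \<le> degree p)"

lemma ex_least_relation:
  assumes "p \<in> polys_over S" "p \<noteq> 0" "poly p x = 0"
  obtains m where "least_relation S x m"
proof -
  define Q where "Q q \<longleftrightarrow> q \<in> polys_over S \<and> q \<noteq> 0 \<and> poly q x = 0" for q
  have "Q p" using assms by (auto simp: Q_def)
  then obtain m where "Q m" "\<forall>q. Q q \<longrightarrow> degree m \<le> degree q"
    using ex_has_least_nat[of Q p degree] by blast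
  then show ?thesis using that unfolding least_relation_def Q_def by blast
qed

text \<open>The remainder of \<open>p\<close> modulo \<open>m\<close> vanishes at \<open>x\<close>,
  so minimality makes it zero, and a power of the leading coefficient times \<open>p\<close> is a
  multiple of \<open>m\<close>. Cancellation is the hypothesis \<open>canc\<close> because the
  target may have zero divisors, as the dual numbers do.\<close>

lemma least_relation_kernel:
  fixes S :: "'a::idom set" and \<phi> :: "'a \<Rightarrow> 'b::comm_ring_1"
  assumes S: "is_subring S" and \<phi>: "ring_hom_on S \<phi>" and m: "least_relation S x m"
    and y: "poly (map_poly \<phi> m) y = 0"
    and canc: "\<And>u. \<phi> (lead_coeff m) * u = 0 \<Longrightarrow> u = 0"
    and p: "p \<in> polys_over S" "poly p x = 0"
  shows "poly (map_poly \<phi> p) y = 0"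
proof -
  have m': "m \<in> polys_over S" "m \<noteq> 0" "poly m x = 0" using m by (auto simp: least_relation_def)
  let ?c = "lead_coeff m"
  obtain k q r where *: "q \<in> polys_over S" "r \<in> polys_over S"
    "smult (?c ^ k) p = q * m + r" "r = 0 \<or> degree r < degree m"
    by (rule pseudo_division[OF S m'(1,2) p(1)])
  have c: "?c \<in> S" by (rule polys_over_lead_coeff[OF S m'(1)])
  have "poly r x = 0" using arg_cong[OF *(3), of "\<lambda>p. poly p x"] p m' by simp
  then have "r = 0" using m *(2,4) by (force simp: least_relation_def)
  then have eq: "[:?c ^ k:] * p = q * m" using * by simp
  have ck: "[:?c ^ k:] \<in> polys_over S"
    by (intro polys_over_pCons[OF S] subring_power[OF S] c polys_over_zero[OF S])
  note h = ring_hom_on_map_poly[OF S \<phi>]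
  have "map_poly \<phi> [:?c ^ k:] * map_poly \<phi> p = map_poly \<phi> q * map_poly \<phi> m"
    using h eq *(1) m'(1) ck p(1) unfolding ring_hom_on_def by metis
  from arg_cong[OF this, of "\<lambda>p. poly p y"]
  have "\<phi> ?c ^ k * poly (map_poly \<phi> p) y = 0"
    using y ring_hom_on_zero[OF S \<phi>] ring_hom_on_power[OF S \<phi> c] by (simp add: map_poly_const)
  then show ?thesis
  proof (induction k)
    case (Suc k)
    then show ?case using canc by (simp add: mult.assoc)
  qed auto
qed

text \<open>A polynomial \<open>r\<close> of least degree for which \<open>r(x)\<close> is a nonzero multiple of \<open>g\<close> must be
  constant, as otherwise dividing \<open>m\<close> by \<open>r\<close> gives a smaller one.\<close>

lemma least_relation_multiple:
  fixes S :: "'a::idom set"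
  assumes S: "is_subring S" and m: "least_relation S x m"
    and g: "g \<in> adjoin S x" "g \<noteq> 0"
  obtains w where "w \<in> adjoin S x" "w * g \<in> S" "w * g \<noteq> 0"
proof -
  have m': "m \<in> polys_over S" "m \<noteq> 0" "poly m x = 0" using m by (auto simp: least_relation_def)
  have PS: "is_subring (polys_over S)" by (rule is_subring_polys_over[OF S])
  have AS: "is_subring (adjoin S x)" by (rule is_subring_adjoin[OF S])
  define Q where "Q r \<longleftrightarrow> r \<in> polys_over S \<and> poly r x \<noteq> 0 \<and> (\<exists>w\<in>adjoin S x. poly r x = w * g)" for r
  obtain r0 where "r0 \<in> polys_over S" "g = poly r0 x" using g unfolding adjoin_def by blast
  then have "Q r0" using g(2) subring_one[OF AS] unfolding Q_def by force
  then obtain r where r: "Q r" "\<forall>q. Q q \<longrightarrow> degree r \<le> degree q"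
    using ex_has_least_nat[of Q r0 degree] by blast
  then obtain w where w: "w \<in> adjoin S x" "poly r x = w * g" unfolding Q_def by blast
  have r': "r \<in> polys_over S" "poly r x \<noteq> 0" using r unfolding Q_def by auto
  then have r0: "r \<noteq> 0" by auto
  have "degree r = 0"
  proof (rule ccontr)
    assume dr: "degree r \<noteq> 0"
    obtain k q s where *: "q \<in> polys_over S" "s \<in> polys_over S"
      "smult (lead_coeff r ^ k) m = q * r + s" "s = 0 \<or> degree s < degree r"
      by (rule pseudo_division[OF S r'(1) r0 m'(1)])
    have c: "lead_coeff r ^ k \<noteq> 0" using r0 by simp
    have sx: "poly s x = - poly q x * poly r x"
      using arg_cong[OF *(3), of "\<lambda>p. poly p x"] m'(3) by (simp add: eq_neg_iff_add_eq_0 add.commute)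
    \<comment> \<open>Once \<open>q(x)\<close> is known to be nonzero, \<open>s\<close> contradicts
      the minimality of \<open>r\<close>. If \<open>q = 0\<close>, then \<open>r\<close> has larger
      degree than \<open>m\<close>, and reducing \<open>r\<close> modulo \<open>m\<close> gives a
      smaller candidate; if \<open>q\<close> is a nonzero relation of \<open>x\<close>, its degree
      is at least that of \<open>m\<close>, while
      \<open>degree q + degree r \<le> degree m\<close>.\<close>
    have "poly q x \<noteq> 0"
    proof
      assume "poly q x = 0"
      show False
      proof (cases "q = 0")
        case True
        then have "s \<noteq> 0" "poly s x = 0" "degree s = degree m" using * c m'(2) sx
          by (auto simp flip: *(3))
        moreover have "degree r > degree m" using * True \<open>s \<noteq> 0\<close> \<open>degree s = degree m\<close> by simp
        moreover obtain k' q' s' where **: "q' \<in> polys_over S" "s' \<in> polys_over S"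
          "smult (lead_coeff m ^ k') r = q' * m + s'" "s' = 0 \<or> degree s' < degree m"
          by (rule pseudo_division[OF S m'(1,2) r'(1)])
        have s'x: "poly s' x = lead_coeff m ^ k' * poly r x"
          using arg_cong[OF **(3), of "\<lambda>p. poly p x"] m'(3) by simp
        then have "poly s' x \<noteq> 0" using m'(2) r'(2) by simp
        moreover have "lead_coeff m ^ k' * w \<in> adjoin S x"
          using subset_adjoin[OF S] polys_over_lead_coeff[OF S m'(1)] w(1)
          by (intro subring_mult[OF AS] subring_power[OF AS]) auto
        moreover have "poly s' x = (lead_coeff m ^ k' * w) * g" using s'x w by simp
        ultimately have "Q s'" using **(2) unfolding Q_def by blast
        then have "degree r \<le> degree s'" using r by blast
        then show False using \<open>degree r > degree m\<close> ** \<open>poly s' x \<noteq> 0\<close> by auto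
      next
        case False
        then have "degree m \<le> degree q" using m * \<open>poly q x = 0\<close> by (auto simp: least_relation_def)
        moreover have "degree (q * r) = degree q + degree r" using False r0 by (simp add: degree_mult_eq)
        moreover have "degree (q * r) \<le> degree m"
        proof (rule ccontr)
          assume a: "\<not> degree (q * r) \<le> degree m"
          have "degree s < degree (q * r)" using *(4) \<open>degree (q * r) = _\<close> dr by auto
          then have "degree (q * r + s) = degree (q * r)" by (rule degree_add_eq_left)
          moreover have "degree (q * r + s) \<le> degree m" unfolding *(3)[symmetric] by (rule degree_smult_le)
          ultimately show False using a by simp
        qed
        ultimately show False using dr by simp
      qed
    qed
    then have "poly s x \<noteq> 0" using sx r' by simp
    moreover have "- poly q x * w \<in> adjoin S x" using w * unfolding adjoin_def[of S x]
      by (auto simp flip: adjoin_def intro!: subring_uminus[OF AS] subring_mult[OF AS])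
         (auto simp: adjoin_def)
    moreover have "poly s x = (- poly q x * w) * g" using sx w by simp
    ultimately have "Q s" using *(2) unfolding Q_def by blast
    then have "degree r \<le> degree s" using r by blast
    then show False using *(4) \<open>poly s x \<noteq> 0\<close> by auto
  qed
  then obtain c where "r = [:c:]" by (rule degree_eq_zeroE)
  then have "w * g = c" "c \<in> S" using w r'(1) by (auto simp: polys_over_def coeff_pCons split: nat.splits)
  then show ?thesis using that w r' by auto
qed

text \<open>The single-generator step of Chevalley's theorem: \<open>f\<close> is the leading coefficient of a polynomial
  expression for \<open>g\<close> if \<open>x\<close> is transcendental over \<open>S\<close>, and otherwise the leading coefficient of a
  least relation times a multiple of \<open>g\<close> in \<open>S\<close>.\<close>

lemma extend_hom_nonzero:
  fixes S :: "'a::idom set"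
  assumes S: "is_subring S" and g: "g \<in> adjoin S x" "g \<noteq> 0"
  obtains f where "f \<in> S" "f \<noteq> 0"
    "\<And>\<phi> :: 'a \<Rightarrow> complex. ring_hom_on S \<phi> \<Longrightarrow> \<phi> f \<noteq> 0 \<Longrightarrow>
       \<exists>\<phi>'. ring_hom_on (adjoin S x) \<phi>' \<and> (\<forall>s\<in>S. \<phi>' s = \<phi> s) \<and> \<phi>' g \<noteq> 0"
proof (cases "\<exists>p\<in>polys_over S. p \<noteq> 0 \<and> poly p x = 0")
  case False
  obtain p where p: "p \<in> polys_over S" "g = poly p x" using g unfolding adjoin_def by blast
  have p0: "p \<noteq> 0" using p g by auto
  show ?thesis
  proof
    show "lead_coeff p \<in> S" "lead_coeff p \<noteq> 0" using polys_over_lead_coeff[OF S p(1)] p0 by auto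
    fix \<phi> :: "'a \<Rightarrow> complex"
    assume \<phi>: "ring_hom_on S \<phi>" and nz: "\<phi> (lead_coeff p) \<noteq> 0"
    have "coeff (map_poly \<phi> p) (degree p) \<noteq> 0"
      using nz ring_hom_on_zero[OF S \<phi>] by (simp add: coeff_map_poly)
    \<comment> \<open>A transcendental \<open>x\<close> may be sent anywhere, so \<open>y\<close>
      need only avoid the roots of the image of \<open>p\<close>.\<close>
    then have "map_poly \<phi> p \<noteq> 0" by auto
    then obtain y where y: "poly (map_poly \<phi> p) y \<noteq> 0" using poly_all_0_iff_0 by blast
    have "poly (map_poly \<phi> q) y = 0" if "q \<in> polys_over S" "poly q x = 0" for q
      using False that by auto
    from extend_ring_hom_on[OF S \<phi> this] obtain \<phi>' where
      "ring_hom_on (adjoin S x) \<phi>'" "\<And>s. s \<in> S \<Longrightarrow> \<phi>' s = \<phi> s"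
      "\<And>p. p \<in> polys_over S \<Longrightarrow> \<phi>' (poly p x) = poly (map_poly \<phi> p) y" by metis
    then show "\<exists>\<phi>'. ring_hom_on (adjoin S x) \<phi>' \<and> (\<forall>s\<in>S. \<phi>' s = \<phi> s) \<and> \<phi>' g \<noteq> 0"
      using p y by auto
  qed
next
  case True
  then obtain m where m: "least_relation S x m" using ex_least_relation by blast
  then have m': "m \<in> polys_over S" "m \<noteq> 0" "poly m x = 0" by (auto simp: least_relation_def)
  obtain w where w: "w \<in> adjoin S x" "w * g \<in> S" "w * g \<noteq> 0"
    by (rule least_relation_multiple[OF S m g])
  have lc: "lead_coeff m \<in> S" by (rule polys_over_lead_coeff[OF S m'(1)])
  show ?thesis
  proof
    show "lead_coeff m * (w * g) \<in> S" "lead_coeff m * (w * g) \<noteq> 0"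
      using w m' lc subring_mult[OF S] by auto
    fix \<phi> :: "'a \<Rightarrow> complex"
    assume \<phi>: "ring_hom_on S \<phi>" and "\<phi> (lead_coeff m * (w * g)) \<noteq> 0"
    then have nz: "\<phi> (lead_coeff m) \<noteq> 0" "\<phi> (w * g) \<noteq> 0"
      using lc w(2) by (auto simp: ring_hom_on_def)
    \<comment> \<open>The leading coefficient survives \<open>\<phi>\<close>, so the image of
      \<open>m\<close> is nonconstant and has a complex root, to which \<open>x\<close> is
      sent.\<close>
    have "degree m \<noteq> 0" using m'(2,3) by (metis degree_eq_zeroE poly_const_conv poly_0 pCons_eq_0_iff)
    moreover have "coeff (map_poly \<phi> m) (degree m) \<noteq> 0"
      using nz ring_hom_on_zero[OF S \<phi>] by (simp add: coeff_map_poly)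
    ultimately have "degree (map_poly \<phi> m) \<noteq> 0" using le_degree by fastforce
    then obtain y where y: "poly (map_poly \<phi> m) y = 0"
      using fundamental_theorem_of_algebra[of "map_poly \<phi> m"] constant_degree[of "map_poly \<phi> m"] by auto
    have "poly (map_poly \<phi> q) y = 0" if "q \<in> polys_over S" "poly q x = 0" for q
      by (rule least_relation_kernel[OF S \<phi> m y _ that]) (use nz in auto)
    from extend_ring_hom_on[OF S \<phi> this] obtain \<phi>' where \<phi>':
      "ring_hom_on (adjoin S x) \<phi>'" "\<And>s. s \<in> S \<Longrightarrow> \<phi>' s = \<phi> s" by metis
    have "\<phi>' (w * g) = \<phi>' w * \<phi>' g" using \<phi>'(1) w(1) g(1) by (simp add: ring_hom_on_def)
    then have "\<phi>' w * \<phi>' g = \<phi> (w * g)" using \<phi>'(2)[OF w(2)] by simp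
    then show "\<exists>\<phi>'. ring_hom_on (adjoin S x) \<phi>' \<and> (\<forall>s\<in>S. \<phi>' s = \<phi> s) \<and> \<phi>' g \<noteq> 0"
      using \<phi>' nz by (metis mult_zero_right)
  qed
qed

text \<open>\<open>S'\<close> is fixed before \<open>g\<close>. The nonvanishing condition is pulled
  back one generator at a time, from \<open>g\<close> to an element of \<open>adjoin S x\<close> and
  then to \<open>S\<close>; this is why the induction speaks of an arbitrary nonzero
  \<open>g\<close> rather than of 1.\<close>

lemma extend_hom_list:
  fixes S :: "'a::idom set"
  assumes "is_subring S"
  shows "\<exists>S'. is_subring S' \<and> S \<subseteq> S' \<and> set xs \<subseteq> S' \<and> (\<forall>g\<in>S' - {0}. \<exists>f\<in>S - {0}.
    \<forall>\<phi> :: 'a \<Rightarrow> complex. ring_hom_on S \<phi> \<and> \<phi> f \<noteq> 0 \<longrightarrow>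
      (\<exists>\<phi>'. ring_hom_on S' \<phi>' \<and> (\<forall>s\<in>S. \<phi>' s = \<phi> s) \<and> \<phi>' g \<noteq> 0))"
  using assms
proof (induction xs arbitrary: S)
  case Nil
  then show ?case by (intro exI[of _ S]) auto
next
  case (Cons x xs)
  let ?T = "adjoin S x"
  from Cons.IH[OF is_subring_adjoin[OF Cons.prems, of x]] obtain S' where S': "is_subring S'"
    "?T \<subseteq> S'" "set xs \<subseteq> S'" and ext: "\<And>g. g \<in> S' - {0} \<Longrightarrow> \<exists>f\<in>?T - {0}.
    \<forall>\<phi> :: 'a \<Rightarrow> complex. ring_hom_on ?T \<phi> \<and> \<phi> f \<noteq> 0 \<longrightarrow>
      (\<exists>\<phi>'. ring_hom_on S' \<phi>' \<and> (\<forall>s\<in>?T. \<phi>' s = \<phi> s) \<and> \<phi>' g \<noteq> 0)" by metis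
  have sub: "S \<subseteq> ?T" "x \<in> ?T" using subset_adjoin[OF Cons.prems] mem_adjoin[OF Cons.prems] by auto
  show ?case
  proof (intro exI[of _ S'] conjI ballI)
    fix g assume "g \<in> S' - {0}"
    then obtain h where h: "h \<in> ?T - {0}" "\<And>\<phi> :: 'a \<Rightarrow> complex. ring_hom_on ?T \<phi> \<Longrightarrow> \<phi> h \<noteq> 0 \<Longrightarrow>
      \<exists>\<phi>'. ring_hom_on S' \<phi>' \<and> (\<forall>s\<in>?T. \<phi>' s = \<phi> s) \<and> \<phi>' g \<noteq> 0" using ext by metis
    then have h': "h \<in> ?T" "h \<noteq> 0" by auto
    obtain f where f: "f \<in> S" "f \<noteq> 0"
      "\<And>\<phi> :: 'a \<Rightarrow> complex. ring_hom_on S \<phi> \<Longrightarrow> \<phi> f \<noteq> 0 \<Longrightarrow>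
       \<exists>\<phi>'. ring_hom_on ?T \<phi>' \<and> (\<forall>s\<in>S. \<phi>' s = \<phi> s) \<and> \<phi>' h \<noteq> 0"
      using extend_hom_nonzero[OF Cons.prems h'] by metis
    show "\<exists>f\<in>S - {0}. \<forall>\<phi> :: 'a \<Rightarrow> complex. ring_hom_on S \<phi> \<and> \<phi> f \<noteq> 0 \<longrightarrow>
      (\<exists>\<phi>'. ring_hom_on S' \<phi>' \<and> (\<forall>s\<in>S. \<phi>' s = \<phi> s) \<and> \<phi>' g \<noteq> 0)"
    proof (intro bexI[of _ f] allI impI)
      fix \<phi> :: "'a \<Rightarrow> complex" assume "ring_hom_on S \<phi> \<and> \<phi> f \<noteq> 0"
      then obtain \<psi> where "ring_hom_on ?T \<psi>" "\<forall>s\<in>S. \<psi> s = \<phi> s" "\<psi> h \<noteq> 0" using f(3) by blast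
      moreover from this h(2) obtain \<phi>' where
        "ring_hom_on S' \<phi>'" "\<forall>s\<in>?T. \<phi>' s = \<psi> s" "\<phi>' g \<noteq> 0" by blast
      ultimately show "\<exists>\<phi>'. ring_hom_on S' \<phi>' \<and> (\<forall>s\<in>S. \<phi>' s = \<phi> s) \<and> \<phi>' g \<noteq> 0"
        using sub by (intro exI[of _ \<phi>']) auto
    qed (use f in auto)
  qed (use S' sub in auto)
qed

lemma extend_injective_hom:
  fixes S :: "'a::idom set" and \<phi> :: "'a \<Rightarrow> complex"
  assumes S: "is_subring S" and \<phi>: "ring_hom_on S \<phi>"
    and inj: "\<And>s. s \<in> S \<Longrightarrow> \<phi> s = 0 \<Longrightarrow> s = 0" and X: "finite X"
  obtains S' \<phi>' where "is_subring S'" "S \<subseteq> S'" "X \<subseteq> S'" "ring_hom_on S' \<phi>'"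
    "\<And>s. s \<in> S \<Longrightarrow> \<phi>' s = \<phi> s"
proof -
  obtain xs where xs: "set xs = X" using finite_list[OF X] by blast
  obtain S' where S': "is_subring S'" "S \<subseteq> S'" "set xs \<subseteq> S'" and
    *: "\<forall>g\<in>S' - {0}. \<exists>f\<in>S - {0}. \<forall>\<phi> :: 'a \<Rightarrow> complex. ring_hom_on S \<phi> \<and> \<phi> f \<noteq> 0 \<longrightarrow>
      (\<exists>\<phi>'. ring_hom_on S' \<phi>' \<and> (\<forall>s\<in>S. \<phi>' s = \<phi> s) \<and> \<phi>' g \<noteq> 0)"
    using extend_hom_list[OF S, of xs] by (elim exE conjE) (rule that)
  \<comment> \<open>With \<open>g = 1\<close> the condition on \<open>\<phi>'\<close> is automatic,
    and injectivity of \<open>\<phi>\<close> supplies \<open>\<phi> f \<noteq> 0\<close>.\<close>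
  have "1 \<in> S' - {0}" using subring_one[OF S'(1)] by simp
  with * obtain f where f: "f \<in> S" "f \<noteq> 0" "\<forall>\<phi> :: 'a \<Rightarrow> complex. ring_hom_on S \<phi> \<and> \<phi> f \<noteq> 0 \<longrightarrow>
      (\<exists>\<phi>'. ring_hom_on S' \<phi>' \<and> (\<forall>s\<in>S. \<phi>' s = \<phi> s) \<and> \<phi>' 1 \<noteq> 0)" by blast
  have "\<phi> f \<noteq> 0" using inj f by blast
  then obtain \<phi>' where "ring_hom_on S' \<phi>'" "\<forall>s\<in>S. \<phi>' s = \<phi> s" using f(3) \<phi> by blast
  then show ?thesis using that S' xs by blast
qed

section \<open>Dual numbers and derivations\<close>

datatype 'a dual = Dual (re_part: 'a) (eps_part: 'a)

instantiation dual :: (comm_ring_1) comm_ring_1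
begin

definition "0 = Dual 0 0"
definition "1 = Dual 1 0"
definition "a + b = Dual (re_part a + re_part b) (eps_part a + eps_part b)"
definition "a - b = Dual (re_part a - re_part b) (eps_part a - eps_part b)"
definition "- a = Dual (- re_part a) (- eps_part a)"
definition "a * b = Dual (re_part a * re_part b) (re_part a * eps_part b + eps_part a * re_part b)"

instance
  by standard (auto simp: zero_dual_def one_dual_def plus_dual_def minus_dual_def uminus_dual_def
    times_dual_def algebra_simps intro: dual.expand)

end

lemma dual_sel [simp]:
  "re_part 0 = 0" "eps_part 0 = 0" "re_part 1 = 1" "eps_part 1 = 0"
  "re_part (a + b) = re_part a + re_part b" "eps_part (a + b) = eps_part a + eps_part b"
  "re_part (a - b) = re_part a - re_part b" "eps_part (a - b) = eps_part a - eps_part b"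
  "re_part (a * b) = re_part a * re_part b"
  "eps_part (a * b) = re_part a * eps_part b + eps_part a * re_part b"
  by (auto simp: zero_dual_def one_dual_def plus_dual_def minus_dual_def times_dual_def)

lemma eps_part_sum: "eps_part (sum f I) = (\<Sum>i\<in>I. eps_part (f i))"
  by (induction I rule: infinite_finite_induct) auto

text \<open>First-order Taylor expansion at \<open>x + y \<epsilon>\<close>: the derivative of
  \<open>p\<close> at \<open>x\<close> multiplies \<open>y\<close>, and the term at
  \<open>Dual x 0\<close> records the effect of \<open>\<phi>\<close> on the coefficients.\<close>

lemma poly_map_poly_dual:
  fixes \<phi> :: "'a::idom \<Rightarrow> 'a dual"
  assumes S: "is_subring S" and \<phi>: "ring_hom_on S \<phi>" and re: "\<And>s. s \<in> S \<Longrightarrow> re_part (\<phi> s) = s"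
    and p: "p \<in> polys_over S"
  shows "re_part (poly (map_poly \<phi> p) (Dual x y)) = poly p x"
    and "eps_part (poly (map_poly \<phi> p) (Dual x y)) =
      eps_part (poly (map_poly \<phi> p) (Dual x 0)) + y * poly (pderiv p) x"
proof -
  have "re_part (poly (map_poly \<phi> p) (Dual x y)) = poly p x \<and>
    eps_part (poly (map_poly \<phi> p) (Dual x y)) =
      eps_part (poly (map_poly \<phi> p) (Dual x 0)) + y * poly (pderiv p) x" for y
    using p
  proof (induction p arbitrary: y)
    case (pCons a p)
    have a: "a \<in> S" and p: "p \<in> polys_over S"
      using pCons.prems unfolding polys_over_def by (auto simp: coeff_pCons split: nat.splits)
    have m: "map_poly \<phi> (pCons a p) = pCons (\<phi> a) (map_poly \<phi> p)"
      using ring_hom_on_zero[OF S \<phi>]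
      by (intro poly_eqI) (simp add: coeff_map_poly coeff_pCons split: nat.split)
    have "re_part (poly (map_poly \<phi> p) (Dual x 0)) = poly p x" using pCons.IH[OF p] by blast
    then show ?case unfolding m using pCons.IH[OF p, of y] re[OF a]
      by (simp add: pderiv_pCons algebra_simps)
  qed simp
  then show "re_part (poly (map_poly \<phi> p) (Dual x y)) = poly p x"
    "eps_part (poly (map_poly \<phi> p) (Dual x y)) =
      eps_part (poly (map_poly \<phi> p) (Dual x 0)) + y * poly (pderiv p) x" by blast+
qed

text \<open>A homomorphism \<open>s \<mapsto> s + D s \<epsilon>\<close> is the same as a derivation \<open>D\<close>. On an algebraic \<open>x\<close> with least
  relation \<open>m\<close>, the value of \<open>D\<close> is forced by \<open>m\<^sup>D(x) + m'(x) D x = 0\<close>, where \<open>m'(x)\<close> does not vanish.\<close>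

lemma extend_dual_hom:
  fixes \<phi> :: "'a::field_char_0 \<Rightarrow> 'a dual"
  assumes S: "is_subring S" and \<phi>: "ring_hom_on S \<phi>" and re: "\<And>s. s \<in> S \<Longrightarrow> re_part (\<phi> s) = s"
  obtains \<phi>' where "ring_hom_on (adjoin S x) \<phi>'" "\<And>s. s \<in> S \<Longrightarrow> \<phi>' s = \<phi> s"
    "\<And>s. s \<in> adjoin S x \<Longrightarrow> re_part (\<phi>' s) = s"
proof -
  have "\<exists>y. \<forall>p\<in>polys_over S. poly p x = 0 \<longrightarrow> poly (map_poly \<phi> p) (Dual x y) = 0"
  proof (cases "\<exists>p\<in>polys_over S. p \<noteq> 0 \<and> poly p x = 0")
    case False
    \<comment> \<open>An element without relations may receive any derivative; zero is
      chosen.\<close>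
    then have "poly (map_poly \<phi> p) (Dual x 0) = 0" if "p \<in> polys_over S" "poly p x = 0" for p
      using that by auto
    then show ?thesis by blast
  next
    case True
    then obtain m where m: "least_relation S x m" using ex_least_relation by blast
    then have m': "m \<in> polys_over S" "m \<noteq> 0" "poly m x = 0" by (auto simp: least_relation_def)
    have dm: "degree m \<noteq> 0" using m' by (auto elim!: degree_eq_zeroE)
    have nat: "of_nat n \<in> S" for n
      by (induction n) (auto intro: subring_zero[OF S] subring_add[OF S] subring_one[OF S])
    have "pderiv m \<in> polys_over S" using m'(1) subring_mult[OF S nat]
      by (simp add: polys_over_def coeff_pderiv del: of_nat_Suc)
    moreover have "pderiv m \<noteq> 0" using dm by (simp add: pderiv_eq_0_iff)
    moreover have "degree (pderiv m) < degree m" using dm by (simp add: degree_pderiv)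
    \<comment> \<open>In characteristic zero \<open>pderiv m\<close> is a nonzero polynomial of
      smaller degree, so minimality of \<open>m\<close> keeps it from vanishing at
      \<open>x\<close>.\<close>
    ultimately have nz: "poly (pderiv m) x \<noteq> 0" using m by (force simp: least_relation_def)
    define y where "y = - eps_part (poly (map_poly \<phi> m) (Dual x 0)) / poly (pderiv m) x"
    have y: "poly (map_poly \<phi> m) (Dual x y) = 0"
      using poly_map_poly_dual[OF S \<phi> re m'(1), of x y] nz m'(3)
      by (intro dual.expand) (simp add: y_def)
    \<comment> \<open>A dual number with nonzero \<open>re_part\<close> is not a zero divisor, which
      gives the cancellation that \<open>least_relation_kernel\<close> asks for.\<close>
    have "u = 0" if "\<phi> (lead_coeff m) * u = 0" for u
    proof -
      have "re_part (\<phi> (lead_coeff m)) \<noteq> 0" using re[OF polys_over_lead_coeff[OF S m'(1)]] m' by simp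
      moreover from this have "re_part u = 0" using arg_cong[OF that, of re_part] by simp
      ultimately have "eps_part u = 0" using arg_cong[OF that, of eps_part] by simp
      with \<open>re_part u = 0\<close> show ?thesis by (intro dual.expand) simp
    qed
    from least_relation_kernel[OF S \<phi> m y this] show ?thesis by blast
  qed
  then obtain y where y: "\<And>p. p \<in> polys_over S \<Longrightarrow> poly p x = 0 \<Longrightarrow> poly (map_poly \<phi> p) (Dual x y) = 0"
    by blast
  obtain \<phi>' where \<phi>': "ring_hom_on (adjoin S x) \<phi>'" "\<And>s. s \<in> S \<Longrightarrow> \<phi>' s = \<phi> s"
    "\<And>p. p \<in> polys_over S \<Longrightarrow> \<phi>' (poly p x) = poly (map_poly \<phi> p) (Dual x y)"
    using extend_ring_hom_on[OF S \<phi> y] by metis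
  have "re_part (\<phi>' s) = s" if "s \<in> adjoin S x" for s
    using that \<phi>'(3) poly_map_poly_dual(1)[OF S \<phi> re] unfolding adjoin_def by auto
  then show ?thesis using that \<phi>' by blast
qed

lemma extend_dual_hom_finite:
  fixes \<phi> :: "'a::field_char_0 \<Rightarrow> 'a dual"
  assumes "finite X"
    and "is_subring S" "ring_hom_on S \<phi>" "\<forall>s\<in>S. re_part (\<phi> s) = s"
  shows "\<exists>S' \<phi>'. is_subring S' \<and> S \<subseteq> S' \<and> X \<subseteq> S' \<and> ring_hom_on S' \<phi>' \<and>
    (\<forall>s\<in>S. \<phi>' s = \<phi> s) \<and> (\<forall>s\<in>S'. re_part (\<phi>' s) = s)"
  using assms
proof (induction X)
  case empty
  then show ?case by (intro exI[of _ S] exI[of _ \<phi>]) auto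
next
  case (insert x X)
  then obtain S' \<phi>' where S': "is_subring S'" "S \<subseteq> S'" "X \<subseteq> S'" "ring_hom_on S' \<phi>'"
    "\<forall>s\<in>S. \<phi>' s = \<phi> s" "\<forall>s\<in>S'. re_part (\<phi>' s) = s" by blast
  then have "re_part (\<phi>' s) = s" if "s \<in> S'" for s using that by blast
  from extend_dual_hom[OF S'(1,4) this, of x] obtain \<phi>'' where
    "ring_hom_on (adjoin S' x) \<phi>''" "\<And>s. s \<in> S' \<Longrightarrow> \<phi>'' s = \<phi>' s"
    "\<And>s. s \<in> adjoin S' x \<Longrightarrow> re_part (\<phi>'' s) = s" by metis
  then show ?case
    using S' is_subring_adjoin[OF S'(1), of x] subset_adjoin[OF S'(1), of x] mem_adjoin[OF S'(1), of x]
    by (intro exI[of _ "adjoin S' x"] exI[of _ \<phi>'']) (auto simp: subset_iff)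
qed

section \<open>Generic points\<close>

text \<open>Terms for integer polynomials. They can be evaluated in every commutative ring, hence at
  complex numbers, dual numbers, polynomials and power series alike. For countably many variables
  there are only countably many terms, so null sets can be united over all of them.\<close>

datatype 'v pexp = One | Var 'v | Minus "'v pexp" "'v pexp" | Times "'v pexp" "'v pexp"

instance pexp :: (countable) countable
  by countable_datatype

primrec peval :: "('v \<Rightarrow> 'a::comm_ring_1) \<Rightarrow> 'v pexp \<Rightarrow> 'a" where
  "peval z One = 1"
| "peval z (Var v) = z v"
| "peval z (Minus e f) = peval z e - peval z f"
| "peval z (Times e f) = peval z e * peval z f"

lemma is_subring_range_peval: "is_subring (range (peval z))"
  unfolding is_subring_def
  by (auto simp: image_iff intro: peval.simps[symmetric] exI[of _ One] exI[of _ "Minus _ _"] exI[of _ "Times _ _"])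

lemma hom_peval:
  assumes "\<psi> 1 = 1" "\<And>x y. \<psi> (x - y) = \<psi> x - \<psi> y" "\<And>x y. \<psi> (x * y) = \<psi> x * \<psi> y"
  shows "\<psi> (peval z e) = peval (\<lambda>v. \<psi> (z v)) e"
  using assms by (induction e) auto

lemma ring_hom_on_range_peval:
  assumes "\<forall>e. peval z e = 0 \<longrightarrow> peval z' e = 0"
  shows "\<exists>\<phi>. ring_hom_on (range (peval z)) \<phi> \<and> (\<forall>e. \<phi> (peval z e) = peval z' e)"
proof -
  define \<phi> where "\<phi> u = peval z' (SOME e. peval z e = u)" for u
  have ev: "\<phi> (peval z e) = peval z' e" for e
  proof -
    have "peval z (SOME e'. peval z e' = peval z e) = peval z e" by (rule someI) simp
    then have "peval z (Minus (SOME e'. peval z e' = peval z e) e) = 0" by simp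
    with assms show ?thesis by (metis \<phi>_def peval.simps(3) right_minus_eq)
  qed
  have "ring_hom_on (range (peval z)) \<phi>"
    unfolding ring_hom_on_def
  proof (intro conjI ballI)
    show "\<phi> 1 = 1" using ev[of One] by simp
    fix x y assume "x \<in> range (peval z)" "y \<in> range (peval z)"
    then obtain e f where "x = peval z e" "y = peval z f" by blast
    \<comment> \<open>There is no constructor for addition: \<open>e + f\<close> is written as
      \<open>e - ((1 - 1) - f)\<close>.\<close>
    then show "\<phi> (x + y) = \<phi> x + \<phi> y" "\<phi> (x * y) = \<phi> x * \<phi> y"
      using ev[of e] ev[of f] ev[of "Times e f"] ev[of "Minus e (Minus (Minus One One) f)"] by auto
  qed
  with ev show ?thesis by (intro exI[of _ \<phi>]) simp
qed

text \<open>The coordinates in \<open>I\<close> are algebraically independent over the rationals; the others are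
  fixed to be zero.\<close>

definition generic_on :: "'v set \<Rightarrow> ('v \<Rightarrow> complex) \<Rightarrow> bool" where
  "generic_on I z \<longleftrightarrow> (\<forall>v. v \<notin> I \<longrightarrow> z v = 0) \<and>
    (\<forall>e. peval z e = 0 \<longrightarrow> (\<forall>w :: 'v \<Rightarrow> complex. (\<forall>v. v \<notin> I \<longrightarrow> w v = 0) \<longrightarrow> peval w e = 0))"

text \<open>Every complex \<open>t\<close> gives a point of the line supported in \<open>I\<close>,
  where a relation of the generic \<open>z\<close> must hold; a polynomial in \<open>t\<close> that
  vanishes at all complex numbers is zero.\<close>

lemma generic_on_peval_line:
  fixes a b :: "'v \<Rightarrow> complex"
  assumes "generic_on I z" "peval z e = 0"
    and "\<And>v. v \<notin> I \<Longrightarrow> a v = 0" "\<And>v. v \<notin> I \<Longrightarrow> b v = 0"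
  shows "peval (\<lambda>v. [:a v, b v:]) e = 0"
proof -
  have "poly (peval (\<lambda>v. [:a v, b v:]) e) t = peval (\<lambda>v. poly [:a v, b v:] t) e" for t
    by (rule hom_peval) auto
  moreover have "peval (\<lambda>v. poly [:a v, b v:] t) e = 0" for t
  proof -
    have *: "\<forall>w :: 'v \<Rightarrow> complex. (\<forall>v. v \<notin> I \<longrightarrow> w v = 0) \<longrightarrow> peval w e = 0"
      using assms(1,2) unfolding generic_on_def by blast
    have "\<forall>v. v \<notin> I \<longrightarrow> poly [:a v, b v:] t = 0" using assms(3,4) by simp
    with *[THEN spec, of "\<lambda>v. poly [:a v, b v:] t"] show ?thesis by (rule mp)
  qed
  ultimately show ?thesis using poly_all_0_iff_0 by metis
qed

section \<open>The equation \<open>A H V = I\<close> with sparsity patterns\<close>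

text \<open>Entry \<open>(a, b)\<close> of the product \<open>A H V\<close>. Indices come from
  arbitrary types, so block structure becomes a relation between indices instead of arithmetic with
  offsets.\<close>

definition sandwich ::
  "'r set \<Rightarrow> 't set \<Rightarrow> ('s \<Rightarrow> 'r \<Rightarrow> 'a::comm_ring_1) \<Rightarrow> ('r \<Rightarrow> 't \<Rightarrow> 'a) \<Rightarrow> ('t \<Rightarrow> 's \<Rightarrow> 'a) \<Rightarrow> 's \<Rightarrow> 's \<Rightarrow> 'a" where
  "sandwich R T A H V a b = (\<Sum>i\<in>R. \<Sum>l\<in>T. A a i * H i l * V l b)"

definition supported :: "('x \<Rightarrow> 'y \<Rightarrow> bool) \<Rightarrow> ('x \<Rightarrow> 'y \<Rightarrow> 'a::zero) \<Rightarrow> bool" where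
  "supported \<rho> A \<longleftrightarrow> (\<forall>x y. \<not> \<rho> x y \<longrightarrow> A x y = 0)"

definition solves where
  "solves S R T \<rho> \<tau> H A V \<longleftrightarrow> supported \<rho> A \<and> supported \<tau> V \<and>
     (\<forall>a\<in>S. \<forall>b\<in>S. sandwich R T A H V a b = (if a = b then 1 else 0))"

text \<open>Surjectivity of the derivative of \<open>(A, V) \<mapsto> A H V\<close> for fixed \<open>H\<close>.\<close>

definition tangent_surj where
  "tangent_surj S R T \<rho> \<tau> H A V \<longleftrightarrow> (\<forall>X. \<exists>A' V'. supported \<rho> A' \<and> supported \<tau> V' \<and>
     (\<forall>a\<in>S. \<forall>b\<in>S. sandwich R T A' H V a b + sandwich R T A H V' a b = X a b))"

section \<open>Surjectivity of the tangent map at generic solutions\<close>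

lemma sum_sum_mult:
  fixes f :: "'i \<Rightarrow> 'a::comm_ring_1"
  shows "(\<Sum>i\<in>I. \<Sum>l\<in>L. f i * x * g l) = sum f I * x * sum g L"
  by (simp only: sum_distrib_left[symmetric] sum_distrib_right[symmetric])

text \<open>Here \<open>E = (H V) X (A H)\<close>, so \<open>A E V = (A H V) X (A H V) = X\<close>:
  every \<open>X\<close> arises from some direction \<open>E\<close>.\<close>

lemma sandwich_factor:
  fixes A :: "'s \<Rightarrow> 'r \<Rightarrow> 'a::comm_ring_1" and X :: "'s \<Rightarrow> 's \<Rightarrow> 'a"
  assumes fin: "finite S" and inS: "a \<in> S" "b \<in> S"
    and sol: "\<And>a b. a \<in> S \<Longrightarrow> b \<in> S \<Longrightarrow> sandwich R T A H V a b = (if a = b then 1 else 0)"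
  defines "E \<equiv> \<lambda>i l. \<Sum>c\<in>S. \<Sum>d\<in>S. (\<Sum>l'\<in>T. H i l' * V l' c) * X c d * (\<Sum>i'\<in>R. A d i' * H i' l)"
  shows "sandwich R T A E V a b = X a b"
proof -
  have "sandwich R T A E V a b =
    (\<Sum>i\<in>R. \<Sum>l\<in>T. \<Sum>c\<in>S. \<Sum>d\<in>S. (A a i * (\<Sum>l'\<in>T. H i l' * V l' c)) * X c d * ((\<Sum>i'\<in>R. A d i' * H i' l) * V l b))"
    by (simp add: sandwich_def E_def sum_distrib_left sum_distrib_right mult.assoc)
  also have "\<dots> = (\<Sum>i\<in>R. \<Sum>c\<in>S. \<Sum>l\<in>T. \<Sum>d\<in>S. (A a i * (\<Sum>l'\<in>T. H i l' * V l' c)) * X c d * ((\<Sum>i'\<in>R. A d i' * H i' l) * V l b))"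
    by (intro sum.cong refl sum.swap)
  also have "\<dots> = (\<Sum>c\<in>S. \<Sum>i\<in>R. \<Sum>l\<in>T. \<Sum>d\<in>S. (A a i * (\<Sum>l'\<in>T. H i l' * V l' c)) * X c d * ((\<Sum>i'\<in>R. A d i' * H i' l) * V l b))"
    by (rule sum.swap)
  also have "\<dots> = (\<Sum>c\<in>S. \<Sum>i\<in>R. \<Sum>d\<in>S. \<Sum>l\<in>T. (A a i * (\<Sum>l'\<in>T. H i l' * V l' c)) * X c d * ((\<Sum>i'\<in>R. A d i' * H i' l) * V l b))"
    by (intro sum.cong refl sum.swap)
  also have "\<dots> = (\<Sum>c\<in>S. \<Sum>d\<in>S. \<Sum>i\<in>R. \<Sum>l\<in>T. (A a i * (\<Sum>l'\<in>T. H i l' * V l' c)) * X c d * ((\<Sum>i'\<in>R. A d i' * H i' l) * V l b))"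
    by (intro sum.cong refl sum.swap)
  also have "\<dots> = (\<Sum>c\<in>S. \<Sum>d\<in>S. (\<Sum>i\<in>R. A a i * (\<Sum>l'\<in>T. H i l' * V l' c)) * X c d * (\<Sum>l\<in>T. (\<Sum>i'\<in>R. A d i' * H i' l) * V l b))"
    by (simp only: sum_sum_mult)
  also have "\<dots> = (\<Sum>c\<in>S. \<Sum>d\<in>S. sandwich R T A H V a c * X c d * sandwich R T A H V d b)"
  proof -
    have "(\<Sum>i\<in>R. A a i * (\<Sum>l'\<in>T. H i l' * V l' c)) = sandwich R T A H V a c" for c
      by (simp add: sandwich_def sum_distrib_left mult.assoc)
    moreover have "(\<Sum>l\<in>T. (\<Sum>i'\<in>R. A d i' * H i' l) * V l b) = sandwich R T A H V d b" for d
      by (simp add: sandwich_def sum_distrib_right sum.swap[of _ R])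
    ultimately show ?thesis by simp
  qed
  also have "\<dots> = (\<Sum>c\<in>S. \<Sum>d\<in>S. if d = b then (if a = c then X c d else 0) else 0)"
    by (intro sum.cong) (auto simp: sol inS)
  also have "\<dots> = X a b"
    using fin inS by (simp add: sum.delta)
  finally show ?thesis .
qed

text \<open>Differentiate \<open>A H V = I\<close> along a derivation of the complex numbers that moves the generic
  matrix \<open>H\<close> in the direction \<open>E\<close>; derivations are encoded as homomorphisms to the dual numbers.\<close>

lemma generic_tangent_surj:
  fixes A :: "'s \<Rightarrow> 'r \<Rightarrow> complex" and V :: "'t \<Rightarrow> 's \<Rightarrow> complex"
  assumes fin: "finite S" "finite R" "finite T"
    and gen: "generic_on (R \<times> T) (\<lambda>(i, l). H i l)"
    and sol: "solves S R T \<rho> \<tau> H A V"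
  shows "tangent_surj S R T \<rho> \<tau> H A V"
  unfolding tangent_surj_def
proof
  fix X :: "'s \<Rightarrow> 's \<Rightarrow> complex"
  let ?H = "\<lambda>(i, l). H i l"
  have sup: "supported \<rho> A" "supported \<tau> V" and
    eq: "\<And>a b. a \<in> S \<Longrightarrow> b \<in> S \<Longrightarrow> sandwich R T A H V a b = (if a = b then 1 else 0)"
    using sol by (auto simp: solves_def)
  define E where "E = (\<lambda>i l. \<Sum>c\<in>S. \<Sum>d\<in>S. (\<Sum>l'\<in>T. H i l' * V l' c) * X c d * (\<Sum>i'\<in>R. A d i' * H i' l))"
  define E' where "E' v = (if v \<in> R \<times> T then E (fst v) (snd v) else 0)" for v
  have E: "sandwich R T A E V a b = X a b" if "a \<in> S" "b \<in> S" for a b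
    unfolding E_def by (rule sandwich_factor[OF fin(1) that eq])
  have ker: "peval (\<lambda>v. Dual (?H v) (E' v)) e = 0" if e: "peval ?H e = 0" for e
  proof -
    \<comment> \<open>\<open>\<psi>\<close> reduces polynomials in \<open>t\<close> modulo
      \<open>t^2\<close>; it carries the line \<open>H + t E'\<close> to the dual point, and
      relations of \<open>H\<close> vanish along the line.\<close>
    define \<psi> :: "complex poly \<Rightarrow> complex dual" where "\<psi> p = Dual (coeff p 0) (coeff p 1)" for p
    have "\<psi> (peval (\<lambda>v. [:?H v, E' v:]) e) = peval (\<lambda>v. \<psi> [:?H v, E' v:]) e"
      by (rule hom_peval) (auto simp: \<psi>_def one_dual_def minus_dual_def times_dual_def coeff_mult)
    moreover have "peval (\<lambda>v. [:?H v, E' v:]) e = 0"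
      by (rule generic_on_peval_line[OF gen e]) (use gen in \<open>auto simp: generic_on_def E'_def\<close>)
    ultimately show ?thesis by (simp add: \<psi>_def zero_dual_def)
  qed
  obtain \<phi>0 where \<phi>0: "ring_hom_on (range (peval ?H)) \<phi>0"
    "\<forall>e. \<phi>0 (peval ?H e) = peval (\<lambda>v. Dual (?H v) (E' v)) e"
    using ring_hom_on_range_peval[of ?H "\<lambda>v. Dual (?H v) (E' v)"] ker by blast
  have re: "\<forall>s\<in>range (peval ?H). re_part (\<phi>0 s) = s"
  proof
    fix s assume "s \<in> range (peval ?H)"
    then obtain e where "s = peval ?H e" by blast
    then show "re_part (\<phi>0 s) = s" using \<phi>0(2)[THEN spec, of e] hom_peval[of re_part "\<lambda>v. Dual (?H v) (E' v)" e] by simp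
  qed
  have fin': "finite (case_prod A ` (S \<times> R) \<union> case_prod V ` (T \<times> S))" using fin by blast
  obtain F \<phi> where F: "is_subring F" "range (peval ?H) \<subseteq> F"
    "case_prod A ` (S \<times> R) \<union> case_prod V ` (T \<times> S) \<subseteq> F" "ring_hom_on F \<phi>"
    "\<forall>s\<in>range (peval ?H). \<phi> s = \<phi>0 s" "\<forall>s\<in>F. re_part (\<phi> s) = s"
    using extend_dual_hom_finite[OF fin' is_subring_range_peval \<phi>0(1) re]
    by (elim exE conjE) (rule that)
  have A: "A a i \<in> F" if "a \<in> S" "i \<in> R" for a i using F(3) that by auto
  have V: "V l b \<in> F" if "l \<in> T" "b \<in> S" for l b using F(3) that by auto
  have Hr: "H i l = peval ?H (Var (i, l))" for i l by simp
  have H: "H i l \<in> F" for i l using F(2) Hr by blast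
  have \<phi>H: "\<phi> (H i l) = Dual (H i l) (E i l)" if "i \<in> R" "l \<in> T" for i l
  proof -
    have "\<phi> (peval ?H (Var (i, l))) = \<phi>0 (peval ?H (Var (i, l)))" using F(5) by blast
    then show ?thesis using that \<phi>0(2)[THEN spec, of "Var (i, l)"] by (simp add: E'_def)
  qed
  \<comment> \<open>The sign turns \<open>(D A) H V + X + A H (D V) = 0\<close> into the required
    equation. Cutting down to the pattern changes nothing, since \<open>\<phi>\<close> maps zero
    entries to zero.\<close>
  define A' where "A' a i = (if \<rho> a i then - eps_part (\<phi> (A a i)) else 0)" for a i
  define V' where "V' l b = (if \<tau> l b then - eps_part (\<phi> (V l b)) else 0)" for l b
  note \<phi>_zero = ring_hom_on_zero[OF F(1,4)]
  have A': "A' a i = - eps_part (\<phi> (A a i))" for a i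
    using sup(1) by (auto simp: A'_def supported_def \<phi>_zero)
  have V': "V' l b = - eps_part (\<phi> (V l b))" for l b
    using sup(2) by (auto simp: V'_def supported_def \<phi>_zero)
  have "sandwich R T A' H V a b + sandwich R T A H V' a b = X a b" if ab: "a \<in> S" "b \<in> S" for a b
  proof -
    have "\<phi> (sandwich R T A H V a b) = (\<Sum>i\<in>R. \<phi> (\<Sum>l\<in>T. A a i * H i l * V l b))"
      unfolding sandwich_def
      by (intro ring_hom_on_sum[OF F(1,4)] subring_sum[OF F(1)] subring_mult[OF F(1)] A V H ab)
    also have "\<dots> = (\<Sum>i\<in>R. \<Sum>l\<in>T. \<phi> (A a i * H i l * V l b))"
      by (intro sum.cong refl ring_hom_on_sum[OF F(1,4)] subring_mult[OF F(1)] A V H ab)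
    also have "\<dots> = (\<Sum>i\<in>R. \<Sum>l\<in>T. \<phi> (A a i) * \<phi> (H i l) * \<phi> (V l b))"
    proof (intro sum.cong refl)
      fix i l assume "i \<in> R" "l \<in> T"
      then have "A a i \<in> F" "H i l \<in> F" "A a i * H i l \<in> F" "V l b \<in> F"
        using A V H ab subring_mult[OF F(1)] by auto
      then show "\<phi> (A a i * H i l * V l b) = \<phi> (A a i) * \<phi> (H i l) * \<phi> (V l b)"
        using F(4) unfolding ring_hom_on_def by metis
    qed
    finally have "eps_part (\<phi> (sandwich R T A H V a b)) =
      (\<Sum>i\<in>R. \<Sum>l\<in>T. eps_part (\<phi> (A a i) * \<phi> (H i l) * \<phi> (V l b)))"
      by (simp only: eps_part_sum)
    also have "\<dots> = (\<Sum>i\<in>R. \<Sum>l\<in>T. A a i * H i l * eps_part (\<phi> (V l b)) + A a i * E i l * V l b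
        + eps_part (\<phi> (A a i)) * H i l * V l b)"
      using A V H F(6) ab by (intro sum.cong refl) (simp add: \<phi>H algebra_simps)
    also have "\<dots> = - sandwich R T A H V' a b + X a b - sandwich R T A' H V a b"
      unfolding E[OF ab, symmetric] by (simp add: sandwich_def A' V' sum.distrib sum_negf)
    also have "eps_part (\<phi> (sandwich R T A H V a b)) = 0"
      using eq[OF ab] \<phi>_zero F(4) by (auto simp: ring_hom_on_def)
    finally show ?thesis by (simp add: algebra_simps)
  qed
  moreover have "supported \<rho> A'" "supported \<tau> V'" by (auto simp: supported_def A'_def V'_def)
  ultimately show "\<exists>A' V'. supported \<rho> A' \<and> supported \<tau> V' \<and>
     (\<forall>a\<in>S. \<forall>b\<in>S. sandwich R T A' H V a b + sandwich R T A H V' a b = X a b)" by blast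
qed

text \<open>In coefficient \<open>n\<close> of the product the two unknowns \<open>a_n\<close> and
  \<open>v_n\<close> enter linearly, multiplied by constant terms only, while all that remains
  depends on earlier coefficients of \<open>a\<close> and \<open>v\<close>.\<close>

lemma fps_triple_nth_cutoff:
  fixes a h v :: "'a::comm_ring_1 fps"
  assumes "0 < n"
  shows "fps_nth (a * h * v) n = fps_nth (fps_cutoff n a * h * fps_cutoff n v) n
    + fps_nth a n * fps_nth h 0 * fps_nth v 0 + fps_nth a 0 * fps_nth h 0 * fps_nth v n"
proof -
  let ?a = "fps_cutoff n a" and ?v = "fps_cutoff n v"
  let ?a' = "fps_shift n a" and ?v' = "fps_shift n v"
  have "(fps_X ^ n * ?a' + ?a) * h * v = fps_X ^ n * (?a' * h * v) + ?a * h * v"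
    by (simp add: algebra_simps)
  moreover have "?a * h * (fps_X ^ n * ?v' + ?v) = fps_X ^ n * (?a * h * ?v') + ?a * h * ?v"
    by (simp add: algebra_simps)
  ultimately have "a * h * v = fps_X ^ n * (?a' * h * v) + fps_X ^ n * (?a * h * ?v') + ?a * h * ?v"
    unfolding fps_shift_cutoff' by simp
  then have "fps_nth (a * h * v) n = fps_nth (?a' * h * v) 0 + fps_nth (?a * h * ?v') 0 + fps_nth (?a * h * ?v) n"
    by (simp add: fps_X_power_mult_nth)
  then show ?thesis using assms by (simp add: algebra_simps)
qed

lemma fps_nth_sandwich:
  "fps_nth (sandwich R T A H V a b) n = (\<Sum>i\<in>R. \<Sum>l\<in>T. fps_nth (A a i * H i l * V l b) n)"
  by (simp add: sandwich_def fps_sum_nth)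

text \<open>Hensel lifting, one coefficient at a time.\<close>

lemma tangent_surj_lift:
  fixes A0 :: "'s \<Rightarrow> 'r \<Rightarrow> 'a::comm_ring_1" and V0 :: "'t \<Rightarrow> 's \<Rightarrow> 'a" and h :: "'r \<Rightarrow> 't \<Rightarrow> 'a fps"
  assumes sol: "solves S R T \<rho> \<tau> (\<lambda>i l. fps_nth (h i l) 0) A0 V0"
    and surj: "tangent_surj S R T \<rho> \<tau> (\<lambda>i l. fps_nth (h i l) 0) A0 V0"
  obtains A V where "solves S R T \<rho> \<tau> h A V"
proof -
  let ?h0 = "\<lambda>i l. fps_nth (h i l) 0"
  let ?A = "\<lambda>f a i. Abs_fps (\<lambda>m. fst (f m) a i)" and ?V = "\<lambda>f l b. Abs_fps (\<lambda>m. snd (f m) l b)"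
  \<comment> \<open>For \<open>n > 0\<close>, \<open>P f n r\<close> says that \<open>r\<close> may
    serve as \<open>n\<close>-th coefficient pair after \<open>f 0, ..., f (n - 1)\<close>: its
    image under the tangent map cancels the coefficient left by the truncated series. It looks at
    \<open>f\<close> only below \<open>n\<close>, as recursive choice requires.\<close>
  define P :: "(nat \<Rightarrow> ('s \<Rightarrow> 'r \<Rightarrow> 'a) \<times> ('t \<Rightarrow> 's \<Rightarrow> 'a)) \<Rightarrow> nat \<Rightarrow> ('s \<Rightarrow> 'r \<Rightarrow> 'a) \<times> ('t \<Rightarrow> 's \<Rightarrow> 'a) \<Rightarrow> bool"
    where "P f n r \<longleftrightarrow> (if n = 0 then r = (A0, V0) else supported \<rho> (fst r) \<and> supported \<tau> (snd r) \<and>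
      (\<forall>a\<in>S. \<forall>b\<in>S. sandwich R T (fst r) ?h0 V0 a b + sandwich R T A0 ?h0 (snd r) a b =
        - fps_nth (sandwich R T (\<lambda>a i. fps_cutoff n (?A f a i)) h (\<lambda>l b. fps_cutoff n (?V f l b)) a b) n))"
    for f n r
  have "\<exists>f. \<forall>n. P f n (f n)"
  proof (rule dependent_wf_choice[OF wf_less])
    fix f g :: "nat \<Rightarrow> ('s \<Rightarrow> 'r \<Rightarrow> 'a) \<times> ('t \<Rightarrow> 's \<Rightarrow> 'a)" and n r
    assume *: "\<And>z. (z, n) \<in> {(x, y). x < y} \<Longrightarrow> f z = g z"
    have "fps_cutoff n (?A f a i) = fps_cutoff n (?A g a i)" for a i
      by (rule fps_ext) (simp add: *)
    moreover have "fps_cutoff n (?V f l b) = fps_cutoff n (?V g l b)" for l b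
      by (rule fps_ext) (simp add: *)
    ultimately show "P f n r = P g n r" by (simp add: P_def)
  next
    fix n f
    show "\<exists>r. P f n r"
    proof (cases "n = 0")
      case False
      let ?rhs = "\<lambda>a b. - fps_nth (sandwich R T (\<lambda>a i. fps_cutoff n (?A f a i)) h
        (\<lambda>l b. fps_cutoff n (?V f l b)) a b) n"
      obtain A' V' where "supported \<rho> A'" "supported \<tau> V'"
        "\<forall>a\<in>S. \<forall>b\<in>S. sandwich R T A' ?h0 V0 a b + sandwich R T A0 ?h0 V' a b = ?rhs a b"
        using surj[unfolded tangent_surj_def, THEN spec, of ?rhs] by (elim exE conjE) (rule that)
      then have "P f n (A', V')" using False by (simp add: P_def)
      then show ?thesis by blast
    qed (simp add: P_def)
  qed
  then obtain f where f: "\<And>n. P f n (f n)" by blast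
  have f0: "f 0 = (A0, V0)" using f[of 0] by (simp add: P_def)
  have sup: "supported \<rho> (fst (f n)) \<and> supported \<tau> (snd (f n))" for n
    using f[of n] f0 sol by (cases "n = 0") (auto simp: P_def solves_def)
  have "sandwich R T (?A f) h (?V f) a b = (if a = b then 1 else 0)" if ab: "a \<in> S" "b \<in> S" for a b
  proof (rule fps_ext)
    fix n
    show "fps_nth (sandwich R T (?A f) h (?V f) a b) n = fps_nth (if a = b then 1 else 0) n"
    proof (cases "n = 0")
      case True
      have "fps_nth (sandwich R T (?A f) h (?V f) a b) 0 = sandwich R T A0 ?h0 V0 a b"
        unfolding fps_nth_sandwich by (simp add: f0 sandwich_def)
      then show ?thesis using True sol ab by (auto simp: solves_def)
    next
      case False
      then have nth_n: "fps_nth (?A f a i * h i l * ?V f l b) n =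
        fps_nth (fps_cutoff n (?A f a i) * h i l * fps_cutoff n (?V f l b)) n
        + fst (f n) a i * ?h0 i l * V0 l b + A0 a i * ?h0 i l * snd (f n) l b" for i l
        using fps_triple_nth_cutoff[of n "?A f a i" "h i l" "?V f l b"] by (simp add: f0)
      have "fps_nth (sandwich R T (?A f) h (?V f) a b) n =
        fps_nth (sandwich R T (\<lambda>a i. fps_cutoff n (?A f a i)) h (\<lambda>l b. fps_cutoff n (?V f l b)) a b) n
        + (sandwich R T (fst (f n)) ?h0 V0 a b + sandwich R T A0 ?h0 (snd (f n)) a b)"
        unfolding fps_nth_sandwich nth_n by (simp only: sandwich_def sum.distrib add.assoc)
      also have "\<dots> = 0" using f[of n] False ab by (simp add: P_def)
      finally show ?thesis using False by simp
    qed
  qed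
  moreover have "supported \<rho> (?A f)" "supported \<tau> (?V f)"
    using sup by (auto simp: supported_def fps_eq_iff)
  ultimately show ?thesis using that unfolding solves_def by blast
qed

text \<open>The formal solution along the line from \<open>H\<^sub>0\<close> to \<open>H\<close> is specialised at \<open>t = 1\<close>. Power series
  cannot be evaluated there, but the entries of the line can, and this evaluation extends to the
  ring generated by the solution because it is injective for generic \<open>H\<close>.\<close>

lemma generic_solution:
  fixes A0 :: "'s \<Rightarrow> 'r \<Rightarrow> complex" and V0 :: "'t \<Rightarrow> 's \<Rightarrow> complex"
  assumes fin: "finite S" "finite R" "finite T"
    and sol: "solves S R T \<rho> \<tau> H0 A0 V0" and surj: "tangent_surj S R T \<rho> \<tau> H0 A0 V0"
    and gen: "generic_on (R \<times> T) (\<lambda>(i, l). H i l)"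
  obtains A V where "solves S R T \<rho> \<tau> H A V"
proof -
  let ?H = "\<lambda>(i, l). H i l"
  define a where "a v = (if v \<in> R \<times> T then H0 (fst v) (snd v) else 0)" for v
  \<comment> \<open>The line runs from \<open>H0\<close> at \<open>t = 0\<close> to \<open>H\<close>
    at \<open>t = 1\<close>; outside \<open>R \<times> T\<close> both ends are zero, as
    \<open>generic_on\<close> demands.\<close>
  define q where "q v = [:a v, ?H v - a v:]" for v
  define h where "h i l = fps_of_poly (q (i, l))" for i l
  have h0: "fps_nth (h i l) 0 = H0 i l" if "i \<in> R" "l \<in> T" for i l
    using that by (simp add: h_def q_def a_def)
  have "sandwich R T A (\<lambda>i l. fps_nth (h i l) 0) V = sandwich R T A H0 V"
    for A :: "'s \<Rightarrow> 'r \<Rightarrow> complex" and V :: "'t \<Rightarrow> 's \<Rightarrow> complex"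
    unfolding sandwich_def by (intro ext sum.cong refl) (simp add: h0)
  then have "solves S R T \<rho> \<tau> (\<lambda>i l. fps_nth (h i l) 0) A0 V0"
    "tangent_surj S R T \<rho> \<tau> (\<lambda>i l. fps_nth (h i l) 0) A0 V0"
    using sol surj by (simp_all add: solves_def tangent_surj_def)
  then obtain A V where "solves S R T \<rho> \<tau> h A V" by (rule tangent_surj_lift)
  then have sup: "supported \<rho> A" "supported \<tau> V" and
    eq: "\<And>a b. a \<in> S \<Longrightarrow> b \<in> S \<Longrightarrow> sandwich R T A h V a b = (if a = b then 1 else 0)"
    by (auto simp: solves_def)
  let ?h = "\<lambda>v. fps_of_poly (q v)"
  have ph: "peval ?h e = fps_of_poly (peval q e)" for e
    by (rule hom_peval[symmetric]) (simp_all add: fps_of_poly_diff fps_of_poly_mult)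
  have pq: "poly (peval q e) 1 = peval ?H e" for e
    using hom_peval[of "\<lambda>p. poly p 1" q e] by (simp add: q_def)
  have ker: "peval ?H e = 0" if "peval ?h e = 0" for e
    using that pq[of e] by (simp add: ph)
  obtain \<phi>0 where \<phi>0: "ring_hom_on (range (peval ?h)) \<phi>0"
    "\<forall>e. \<phi>0 (peval ?h e) = peval ?H e"
    using ring_hom_on_range_peval[of ?h ?H] ker by blast
  \<comment> \<open>A relation at the generic end \<open>H\<close> holds along the whole line, so
    evaluation at \<open>t = 1\<close> kills no nonzero element.\<close>
  have inj: "s = 0" if s: "s \<in> range (peval ?h)" "\<phi>0 s = 0" for s
  proof -
    obtain e where e: "s = peval ?h e" using s by blast
    then have "peval ?H e = 0" using s \<phi>0(2) by simp
    then have "peval q e = 0" unfolding q_def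
      by (rule generic_on_peval_line[OF gen]) (use gen in \<open>auto simp: a_def generic_on_def\<close>)
    then show ?thesis by (simp add: e ph)
  qed
  have fin': "finite (case_prod A ` (S \<times> R) \<union> case_prod V ` (T \<times> S))" using fin by blast
  obtain F \<phi> where F: "is_subring F" "range (peval ?h) \<subseteq> F"
    "case_prod A ` (S \<times> R) \<union> case_prod V ` (T \<times> S) \<subseteq> F" "ring_hom_on F \<phi>"
    "\<And>s. s \<in> range (peval ?h) \<Longrightarrow> \<phi> s = \<phi>0 s"
    using extend_injective_hom[OF is_subring_range_peval \<phi>0(1) inj fin'] by metis
  have A: "A a i \<in> F" if "a \<in> S" "i \<in> R" for a i using F(3) that by auto
  have V: "V l b \<in> F" if "l \<in> T" "b \<in> S" for l b using F(3) that by auto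
  have hr: "h i l = peval ?h (Var (i, l))" for i l by (simp add: h_def)
  have H: "h i l \<in> F" for i l using F(2) hr by blast
  have \<phi>H: "\<phi> (h i l) = H i l" for i l
    unfolding hr using F(5)[OF rangeI[of "peval ?h" "Var (i, l)"]] \<phi>0(2)[THEN spec, of "Var (i, l)"] by simp
  have "sandwich R T (\<lambda>a i. \<phi> (A a i)) H (\<lambda>l b. \<phi> (V l b)) a b = (if a = b then 1 else 0)"
    if ab: "a \<in> S" "b \<in> S" for a b
  proof -
    have "\<phi> (sandwich R T A h V a b) = (\<Sum>i\<in>R. \<phi> (\<Sum>l\<in>T. A a i * h i l * V l b))"
      unfolding sandwich_def
      by (intro ring_hom_on_sum[OF F(1,4)] subring_sum[OF F(1)] subring_mult[OF F(1)] A V H ab)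
    also have "\<dots> = (\<Sum>i\<in>R. \<Sum>l\<in>T. \<phi> (A a i * h i l * V l b))"
      by (intro sum.cong refl ring_hom_on_sum[OF F(1,4)] subring_mult[OF F(1)] A V H ab)
    also have "\<dots> = (\<Sum>i\<in>R. \<Sum>l\<in>T. \<phi> (A a i) * \<phi> (h i l) * \<phi> (V l b))"
    proof (intro sum.cong refl)
      fix i l assume "i \<in> R" "l \<in> T"
      then have "A a i \<in> F" "h i l \<in> F" "A a i * h i l \<in> F" "V l b \<in> F"
        using A V H ab subring_mult[OF F(1)] by auto
      then show "\<phi> (A a i * h i l * V l b) = \<phi> (A a i) * \<phi> (h i l) * \<phi> (V l b)"
        using F(4) unfolding ring_hom_on_def by metis
    qed
    finally show ?thesis
      using eq[OF ab] ring_hom_on_zero[OF F(1,4)] F(4) by (auto simp: \<phi>H sandwich_def ring_hom_on_def)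
  qed
  moreover have "supported \<rho> (\<lambda>a i. \<phi> (A a i))" "supported \<tau> (\<lambda>l b. \<phi> (V l b))"
    using sup ring_hom_on_zero[OF F(1,4)] by (auto simp: supported_def)
  ultimately show ?thesis using that unfolding solves_def by blast
qed

section \<open>Diagonal copies\<close>

lemma sum_Times: "sum f (A \<times> B) = (\<Sum>x\<in>A. \<Sum>y\<in>B. f (x, y))"
  by (simp add: sum.cartesian_product)

lemma sum_blocks:
  assumes "bij_betw f R' (R \<times> C)" "bij_betw g T' (T \<times> C)"
  shows "(\<Sum>i\<in>R'. \<Sum>l\<in>T'. G (f i) (g l)) =
    (\<Sum>p\<in>C. \<Sum>q\<in>C. \<Sum>i\<in>R. \<Sum>l\<in>T. G (i, p) (l, q))"
proof -
  have "(\<Sum>i\<in>R'. \<Sum>l\<in>T'. G (f i) (g l)) = (\<Sum>i\<in>R \<times> C. \<Sum>l\<in>T \<times> C. G i l)"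
    using assms by (simp add: sum.reindex_bij_betw sum.reindex_bij_betw[of f R' "R \<times> C" "\<lambda>i. \<Sum>l\<in>T \<times> C. G i l"])
  also have "\<dots> = (\<Sum>i\<in>R. \<Sum>p\<in>C. \<Sum>l\<in>T. \<Sum>q\<in>C. G (i, p) (l, q))"
    by (simp only: sum_Times)
  also have "\<dots> = (\<Sum>p\<in>C. \<Sum>i\<in>R. \<Sum>l\<in>T. \<Sum>q\<in>C. G (i, p) (l, q))"
    by (rule sum.swap)
  also have "\<dots> = (\<Sum>p\<in>C. \<Sum>i\<in>R. \<Sum>q\<in>C. \<Sum>l\<in>T. G (i, p) (l, q))"
    by (intro sum.cong refl sum.swap)
  also have "\<dots> = (\<Sum>p\<in>C. \<Sum>q\<in>C. \<Sum>i\<in>R. \<Sum>l\<in>T. G (i, p) (l, q))"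
    by (intro sum.cong refl sum.swap)
  finally show ?thesis .
qed

text \<open>Only the channel is block diagonal, which makes the inner indices share one copy
  \<open>p\<close>. \<open>A\<close> and \<open>V\<close> are left general because tangent
  directions also have off-diagonal blocks.\<close>

lemma sandwich_blocks:
  assumes f: "bij_betw f R' (R \<times> C)" and g: "bij_betw g T' (T \<times> C)" and C: "finite C"
  shows "sandwich R' T' (\<lambda>x y. A (fst (e x)) (snd (e x)) (fst (f y)) (snd (f y)))
      (\<lambda>y z. if snd (f y) = snd (g z) then H (fst (f y)) (fst (g z)) else 0)
      (\<lambda>z x. V (fst (g z)) (snd (g z)) (fst (e x)) (snd (e x))) x x' =
    (\<Sum>p\<in>C. sandwich R T (\<lambda>a i. A a (snd (e x)) i p) H (\<lambda>l b. V l p b (snd (e x')))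
      (fst (e x)) (fst (e x')))"
proof -
  have "(\<Sum>i\<in>R'. \<Sum>l\<in>T'. A (fst (e x)) (snd (e x)) (fst (f i)) (snd (f i)) *
      (if snd (f i) = snd (g l) then H (fst (f i)) (fst (g l)) else 0) *
      V (fst (g l)) (snd (g l)) (fst (e x')) (snd (e x'))) =
    (\<Sum>p\<in>C. \<Sum>q\<in>C. \<Sum>i\<in>R. \<Sum>l\<in>T. A (fst (e x)) (snd (e x)) i p *
      (if p = q then H i l else 0) * V l q (fst (e x')) (snd (e x')))"
    by (subst sum_blocks[OF f g, where G = "\<lambda>y z. A (fst (e x)) (snd (e x)) (fst y) (snd y) *
      (if snd y = snd z then H (fst y) (fst z) else 0) * V (fst z) (snd z) (fst (e x')) (snd (e x'))"])
      (simp cong: if_cong)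
  also have "\<dots> = (\<Sum>p\<in>C. \<Sum>q\<in>C. if p = q then
      (\<Sum>i\<in>R. \<Sum>l\<in>T. A (fst (e x)) (snd (e x)) i p * H i l * V l p (fst (e x')) (snd (e x'))) else 0)"
    by (intro sum.cong refl) auto
  also have "\<dots> = (\<Sum>p\<in>C. \<Sum>i\<in>R. \<Sum>l\<in>T. A (fst (e x)) (snd (e x)) i p * H i l * V l p (fst (e x')) (snd (e x')))"
    using C by simp
  finally show ?thesis by (simp only: sandwich_def)
qed

text \<open>For block diagonal \<open>H\<close>, \<open>A\<close>, \<open>V\<close> with identical blocks the tangent map decouples into one
  copy of the original tangent map per pair of blocks.\<close>

lemma tangent_surj_blocks:
  fixes A :: "'s \<Rightarrow> 'r \<Rightarrow> 'a::comm_ring_1"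
    and e :: "'x \<Rightarrow> 's \<times> 'c" and f :: "'y \<Rightarrow> 'r \<times> 'c" and g :: "'z \<Rightarrow> 't \<times> 'c"
  assumes sol: "solves S R T \<rho> \<tau> H A V" and surj: "tangent_surj S R T \<rho> \<tau> H A V"
    and C: "finite C"
    and e: "inj_on e S'" "e ` S' \<subseteq> S \<times> C"
    and f: "bij_betw f R' (R \<times> C)" and g: "bij_betw g T' (T \<times> C)"
    and \<rho>: "\<And>x y. \<rho> (fst (e x)) (fst (f y)) \<Longrightarrow> \<rho>' x y"
    and \<tau>: "\<And>z x. \<tau> (fst (g z)) (fst (e x)) \<Longrightarrow> \<tau>' z x"
  obtains H' :: "'y \<Rightarrow> 'z \<Rightarrow> 'a" and A' V' where "solves S' R' T' \<rho>' \<tau>' H' A' V'" "tangent_surj S' R' T' \<rho>' \<tau>' H' A' V'"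
proof -
  define H' where "H' = (\<lambda>y z. if snd (f y) = snd (g z) then H (fst (f y)) (fst (g z)) else 0)"
  define bA where "bA a r i p = (if r = p then A a i else 0)" for a i and r p :: 'c
  define bV where "bV l q b r = (if q = r then V l b else 0)" for l b and q r :: 'c
  define A' where "A' = (\<lambda>x y. bA (fst (e x)) (snd (e x)) (fst (f y)) (snd (f y)))"
  define V' where "V' = (\<lambda>z x. bV (fst (g z)) (snd (g z)) (fst (e x)) (snd (e x)))"
  have sup: "supported \<rho> A" "supported \<tau> V" and
    eq: "\<And>a b. a \<in> S \<Longrightarrow> b \<in> S \<Longrightarrow> sandwich R T A H V a b = (if a = b then 1 else 0)"
    using sol by (auto simp: solves_def)
  have eS: "fst (e x) \<in> S" "snd (e x) \<in> C" if "x \<in> S'" for x using e that by auto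
  note blocks = sandwich_blocks[OF f g C]
  have sand0: "sandwich R T (\<lambda>a i. 0) H V0 a b = 0" "sandwich R T A0 H (\<lambda>a i. 0) a b = 0" for A0 V0 and a b :: 's
    by (simp_all add: sandwich_def)
  \<comment> \<open>As \<open>A'\<close> and \<open>H'\<close> are block diagonal, block
    \<open>(r, r')\<close> of the product involves only block \<open>(r, r')\<close> of the third
    factor; \<open>right\<close> is the mirror image.\<close>
  have left: "sandwich R' T' A' H' (\<lambda>z x. B (fst (g z)) (snd (g z)) (fst (e x)) (snd (e x))) x x' =
      sandwich R T A H (\<lambda>l b. B l (snd (e x)) b (snd (e x'))) (fst (e x)) (fst (e x'))"
    if "x \<in> S'" "x' \<in> S'" for B x x'
  proof -
    have "sandwich R T (\<lambda>a i. bA a (snd (e x)) i p) H (\<lambda>l b. B l p b (snd (e x'))) (fst (e x)) (fst (e x')) =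
      (if p = snd (e x) then sandwich R T A H (\<lambda>l b. B l (snd (e x)) b (snd (e x'))) (fst (e x)) (fst (e x')) else 0)"
      for p by (auto simp: bA_def sand0)
    then show ?thesis unfolding A'_def H'_def blocks using C eS[OF that(1)] by (simp only: sum.delta if_True)
  qed
  have right: "sandwich R' T' (\<lambda>x y. B (fst (e x)) (snd (e x)) (fst (f y)) (snd (f y))) H' V' x x' =
      sandwich R T (\<lambda>a i. B a (snd (e x)) i (snd (e x'))) H V (fst (e x)) (fst (e x'))"
    if "x \<in> S'" "x' \<in> S'" for B x x'
  proof -
    have "sandwich R T (\<lambda>a i. B a (snd (e x)) i p) H (\<lambda>l b. bV l p b (snd (e x'))) (fst (e x)) (fst (e x')) =
      (if p = snd (e x') then sandwich R T (\<lambda>a i. B a (snd (e x)) i (snd (e x'))) H V (fst (e x)) (fst (e x')) else 0)"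
      for p by (auto simp: bV_def sand0)
    then show ?thesis unfolding V'_def H'_def blocks using C eS[OF that(2)] by (simp only: sum.delta if_True)
  qed
  have "sandwich R' T' A' H' V' x x' = (if x = x' then 1 else 0)" if x: "x \<in> S'" "x' \<in> S'" for x x'
  proof -
    have "sandwich R' T' A' H' V' x x' =
      sandwich R T A H (\<lambda>l b. bV l (snd (e x)) b (snd (e x'))) (fst (e x)) (fst (e x'))"
      unfolding V'_def by (rule left[OF x])
    also have "\<dots> = (if snd (e x) = snd (e x') then sandwich R T A H V (fst (e x)) (fst (e x')) else 0)"
      by (auto simp: bV_def sand0)
    also have "\<dots> = (if e x = e x' then 1 else 0)"
      using eq eS x by (auto simp: prod_eq_iff)
    finally show ?thesis using e(1) x by (simp add: inj_on_eq_iff)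
  qed
  moreover have "supported \<rho>' A'" using sup(1) \<rho> unfolding supported_def A'_def bA_def by metis
  moreover have "supported \<tau>' V'" using sup(2) \<tau> unfolding supported_def V'_def bV_def by metis
  ultimately have "solves S' R' T' \<rho>' \<tau>' H' A' V'" by (simp add: solves_def)
  moreover have "tangent_surj S' R' T' \<rho>' \<tau>' H' A' V'"
    unfolding tangent_surj_def
  proof
    fix X :: "'x \<Rightarrow> 'x \<Rightarrow> 'a"
    \<comment> \<open>One tangent problem of the small format is solved for each pair of copies, the
      target being the corresponding block of \<open>X\<close>.\<close>
    have "\<forall>r r'. \<exists>B D. supported \<rho> B \<and> supported \<tau> D \<and> (\<forall>a\<in>S. \<forall>b\<in>S.
      sandwich R T B H V a b + sandwich R T A H D a b =
        X (inv_into S' e (a, r)) (inv_into S' e (b, r')))"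
      using surj by (simp add: tangent_surj_def)
    then obtain B D where BD: "\<And>r r'. supported \<rho> (B r r')" "\<And>r r'. supported \<tau> (D r r')"
      "\<And>r r' a b. a \<in> S \<Longrightarrow> b \<in> S \<Longrightarrow> sandwich R T (B r r') H V a b + sandwich R T A H (D r r') a b =
        X (inv_into S' e (a, r)) (inv_into S' e (b, r'))" by metis
    define B' where "B' = (\<lambda>x y. B (snd (e x)) (snd (f y)) (fst (e x)) (fst (f y)))"
    define D' where "D' = (\<lambda>z x. D (snd (g z)) (snd (e x)) (fst (g z)) (fst (e x)))"
    have "sandwich R' T' B' H' V' x x' + sandwich R' T' A' H' D' x x' = X x x'" if x: "x \<in> S'" "x' \<in> S'" for x x'
    proof -
      have "sandwich R' T' B' H' V' x x' = sandwich R T (B (snd (e x)) (snd (e x'))) H V (fst (e x)) (fst (e x'))"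
        unfolding B'_def by (rule right[OF x])
      moreover have "sandwich R' T' A' H' D' x x' = sandwich R T A H (D (snd (e x)) (snd (e x'))) (fst (e x)) (fst (e x'))"
        unfolding D'_def by (rule left[OF x])
      ultimately show ?thesis using BD(3) eS x e(1) by simp
    qed
    moreover have "supported \<rho>' B'" using BD(1) \<rho> unfolding supported_def B'_def by metis
    moreover have "supported \<tau>' D'" using BD(2) \<tau> unfolding supported_def D'_def by metis
    ultimately show "\<exists>B D. supported \<rho>' B \<and> supported \<tau>' D \<and>
     (\<forall>a\<in>S'. \<forall>b\<in>S'. sandwich R' T' B H' V' a b + sandwich R' T' A' H' D a b = X a b)" by blast
  qed
  ultimately show ?thesis by (rule that)
qed

section \<open>Independent continuous random variables are generic\<close>

lemma peval_measurable:
  assumes "\<And>v. v \<in> I \<Longrightarrow> sets (M v) = sets borel"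
  shows "(\<lambda>x. peval (\<lambda>v. if v \<in> I then x v else z v) e :: complex) \<in> borel_measurable (PiM I M)"
proof (induction e)
  case (Var v)
  show ?case
  proof (cases "v \<in> I")
    case True
    then have "(\<lambda>x. x v) \<in> measurable (PiM I M) (M v)" by simp
    then show ?thesis using True assms[OF True] by (simp cong: measurable_cong_sets)
  qed simp
qed auto

text \<open>Induction over the variables: fixing all but one of them leaves a polynomial in one variable,
  whose finitely many roots are not charged.\<close>

lemma AE_PiM_peval_nonzero:
  fixes M :: "'v \<Rightarrow> complex measure"
  assumes "finite I" and M: "\<And>v. prob_space (M v)" "\<And>v. sets (M v) = sets borel"
    and null: "\<And>v x. v \<in> I \<Longrightarrow> emeasure (M v) {x} = 0"
    and "\<And>v. v \<notin> I \<Longrightarrow> w v = z v" "peval w e \<noteq> 0"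
  shows "AE x in PiM I M. peval (\<lambda>v. if v \<in> I then x v else z v) e \<noteq> 0"
  using assms(1) null assms(5,6)
proof (induction I arbitrary: z rule: finite_induct)
  case empty
  then have "w = z" by auto
  then show ?case using empty by simp
next
  case (insert j J)
  interpret product_sigma_finite M
    by (rule product_sigma_finite.intro) (simp add: M(1) prob_space_imp_sigma_finite)
  let ?I = "insert j J"
  let ?p = "\<lambda>x. peval (\<lambda>v. if v \<in> ?I then x v else z v) e"
  define Z where "Z = {x \<in> space (PiM ?I M). ?p x = 0}"
  have [measurable]: "?p \<in> borel_measurable (PiM ?I M)" by (rule peval_measurable) (rule M)
  have Z: "Z \<in> sets (PiM ?I M)" unfolding Z_def by measurable
  \<comment> \<open>Coordinate \<open>j\<close> is frozen at its value in the witness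
    \<open>w\<close>, so \<open>w\<close> still witnesses nonvanishing for the remaining
    variables.\<close>
  have "AE x in PiM J M. peval (\<lambda>v. if v \<in> J then x v else (z(j := w j)) v) e \<noteq> 0"
    by (rule insert.IH) (use insert.prems in auto)
  then have "AE x in PiM J M. (\<integral>\<^sup>+ y. indicator Z (x(j := y)) \<partial>M j) = 0"
  proof eventually_elim
    case (elim x)
    define q where "q = peval (\<lambda>v. if v = j then [:0, 1:] else [:if v \<in> J then x v else z v:]) e"
    have q: "poly q y = ?p (x(j := y))" for y
    proof -
      have "poly q y = peval (\<lambda>v. poly (if v = j then [:0, 1:] else [:if v \<in> J then x v else z v:]) y) e"
        unfolding q_def by (rule hom_peval) auto
      also have "(\<lambda>v. poly (if v = j then [:0, 1:] else [:if v \<in> J then x v else z v:]) y) =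
        (\<lambda>v. if v \<in> ?I then (x(j := y)) v else z v)" by auto
      finally show ?thesis .
    qed
    have "(\<lambda>v. if v \<in> J then x v else (z(j := w j)) v) = (\<lambda>v. if v \<in> ?I then (x(j := w j)) v else z v)"
      using insert.hyps by auto
    then have "poly q (w j) \<noteq> 0" using elim q[of "w j"] by simp
    then have fin: "finite {y. poly q y = 0}" by (intro poly_roots_finite) auto
    have "{y. poly q y = 0} \<in> null_sets (M j)"
    proof -
      have "emeasure (M j) {y. poly q y = 0} = (\<Sum>y\<in>{y. poly q y = 0}. emeasure (M j) {y})"
        by (rule emeasure_eq_sum_singleton[OF fin]) (simp add: M(2))
      then show ?thesis using fin insert.prems(1)[of j]
        by (auto simp: null_sets_def M(2) intro: borel_closed finite_imp_closed)
    qed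
    then have "AE y in M j. y \<notin> {y. poly q y = 0}" by (rule AE_not_in)
    then have "AE y in M j. indicator Z (x(j := y)) = (0 :: ennreal)"
    proof eventually_elim
      case (elim y)
      then have "?p (x(j := y)) \<noteq> 0" using q by simp
      then have "x(j := y) \<notin> Z" unfolding Z_def by blast
      then show ?case by simp
    qed
    then have "(\<integral>\<^sup>+ y. indicator Z (x(j := y)) \<partial>M j) = (\<integral>\<^sup>+ y. 0 \<partial>M j)" by (rule nn_integral_cong_AE)
    then show ?case by simp
  qed
  then have "(\<integral>\<^sup>+ x. \<integral>\<^sup>+ y. indicator Z (x(j := y)) \<partial>M j \<partial>PiM J M) = (\<integral>\<^sup>+ x. 0 \<partial>PiM J M)"
    by (rule nn_integral_cong_AE)
  then have "(\<integral>\<^sup>+ x. indicator Z x \<partial>PiM ?I M) = 0"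
    using product_nn_integral_insert[OF insert.hyps(1,2), of "indicator Z"] Z by simp
  then have "Z \<in> null_sets (PiM ?I M)" using Z by (simp add: null_sets_def)
  then show ?case by (rule AE_I') (auto simp: Z_def)
qed

text \<open>Each term that does not vanish identically on points supported in \<open>I\<close> has a
  null exceptional set, and there are only countably many terms.\<close>

lemma (in prob_space) AE_generic_on:
  fixes X :: "'v::countable \<Rightarrow> 'a \<Rightarrow> complex"
  assumes I: "finite I" "I \<noteq> {}" and indep: "indep_vars (\<lambda>_. borel) X I"
    and cont: "\<And>v. v \<in> I \<Longrightarrow> \<exists>f. distributed M lborel (X v) f"
  shows "AE \<omega> in M. generic_on I (\<lambda>v. if v \<in> I then X v \<omega> else 0)"
proof -
  have rv: "random_variable borel (X v)" if "v \<in> I" for v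
    using indep that by (simp add: indep_vars_def)
  \<comment> \<open>Outside \<open>I\<close> a point mass serves as a default, so that every
    \<open>D v\<close> is a probability measure on the Borel sets.\<close>
  define D where "D v = (if v \<in> I then distr M borel (X v) else return borel 0)" for v
  have D: "prob_space (D v)" "sets (D v) = sets borel" for v
    using rv by (auto simp: D_def intro: prob_space_distr prob_space_return)
  have null: "emeasure (D v) {x} = 0" if v: "v \<in> I" for v x
  proof -
    obtain f where f: "distributed M lborel (X v) f" using cont v by blast
    have f': "f \<in> borel_measurable lborel" using f by (simp add: distributed_def)
    have "emeasure (D v) {x} = emeasure M (X v -` {x} \<inter> space M)"
      using v rv[OF v] by (simp add: D_def emeasure_distr)
    also have "\<dots> = (\<integral>\<^sup>+ y. f y * indicator {x} y \<partial>lborel)"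
      by (rule distributed_emeasure[OF f]) simp
    also have "\<dots> = 0"
      by (rule nn_integral_null_set) (simp add: finite_imp_null_set_lborel)
    finally show ?thesis .
  qed
  have "AE \<omega> in M. peval w e \<noteq> 0 \<longrightarrow> peval (\<lambda>v. if v \<in> I then X v \<omega> else 0) e \<noteq> 0"
    if w: "\<forall>v. v \<notin> I \<longrightarrow> w v = 0" for w :: "'v \<Rightarrow> complex" and e
  proof (cases "peval w e = 0")
    case False
    have "AE x in PiM I D. peval (\<lambda>v. if v \<in> I then x v else 0) e \<noteq> 0"
      by (rule AE_PiM_peval_nonzero[OF I(1) D null]) (use w False in auto)
    also have "PiM I D = PiM I (\<lambda>v. distr M borel (X v))"
      by (rule PiM_cong) (auto simp: D_def)
    also have "\<dots> = distr M (PiM I (\<lambda>_. borel)) (\<lambda>\<omega>. \<lambda>v\<in>I. X v \<omega>)"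
      using indep indep_vars_iff_distr_eq_PiM'[OF I(2), where M' = "\<lambda>_. borel" and X = X] rv by simp
    finally have *: "AE x in distr M (PiM I (\<lambda>_. borel)) (\<lambda>\<omega>. \<lambda>v\<in>I. X v \<omega>).
      peval (\<lambda>v. if v \<in> I then x v else 0) e \<noteq> 0" .
    have "(\<lambda>\<omega>. \<lambda>v\<in>I. X v \<omega>) \<in> measurable M (PiM I (\<lambda>_. borel))"
      by (rule measurable_restrict) (rule rv)
    from AE_distrD[OF this *]
    have "AE \<omega> in M. peval (\<lambda>v. if v \<in> I then (\<lambda>v\<in>I. X v \<omega>) v else 0) e \<noteq> 0" .
    then show ?thesis
    proof eventually_elim
      case (elim \<omega>)
      have "(\<lambda>v. if v \<in> I then (\<lambda>v\<in>I. X v \<omega>) v else 0) = (\<lambda>v. if v \<in> I then X v \<omega> else 0)" by auto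
      then show ?case using elim by simp
    qed
  qed simp
  then have "AE \<omega> in M. (\<exists>w. (\<forall>v. v \<notin> I \<longrightarrow> w v = 0) \<and> peval w e \<noteq> (0 :: complex)) \<longrightarrow>
    peval (\<lambda>v. if v \<in> I then X v \<omega> else 0) e \<noteq> 0" for e
    by (cases "\<exists>w. (\<forall>v. v \<notin> I \<longrightarrow> w v = 0) \<and> peval w e \<noteq> (0 :: complex)") fastforce+
  then have "AE \<omega> in M. \<forall>e. (\<exists>w. (\<forall>v. v \<notin> I \<longrightarrow> w v = 0) \<and> peval w e \<noteq> (0 :: complex)) \<longrightarrow>
    peval (\<lambda>v. if v \<in> I then X v \<omega> else 0) e \<noteq> 0"
    by (subst AE_all_countable) blast
  then show ?thesis
    by eventually_elim (auto simp: generic_on_def)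
qed

text \<open>Renaming variables turns terms into terms. This passes from channel entries, indexed by
  quadruples, to matrices whose rows and columns are pairs of user and position.\<close>

lemma generic_on_reindex:
  assumes gen: "generic_on I z" and g: "bij g"
  shows "generic_on (g -` I) (\<lambda>v. z (g v))"
proof -
  have map: "peval u (map_pexp g e) = peval (\<lambda>v. u (g v)) e" for u :: "_ \<Rightarrow> complex" and e
    by (induction e) auto
  have "peval w e = 0" if e: "peval (\<lambda>v. z (g v)) e = 0" and w: "\<forall>v. v \<notin> g -` I \<longrightarrow> w v = 0"
    for e and w :: "_ \<Rightarrow> complex"
  proof -
    have "\<forall>v. v \<notin> I \<longrightarrow> w (inv_into UNIV g v) = 0" using w g by (simp add: bij_is_surj surj_f_inv_f)
    moreover have "\<forall>w :: _ \<Rightarrow> complex. (\<forall>v. v \<notin> I \<longrightarrow> w v = 0) \<longrightarrow> peval w (map_pexp g e) = 0"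
      using gen e map[of z e] unfolding generic_on_def by metis
    ultimately have "peval (\<lambda>v. w (inv_into UNIV g v)) (map_pexp g e) = 0"
      by (elim allE[of _ "\<lambda>v. w (inv_into UNIV g v)"] mp)
    then show ?thesis using g by (simp add: map bij_is_inj)
  qed
  then show ?thesis using gen by (auto simp: generic_on_def)
qed

section \<open>Interference alignment\<close>

definition indices :: "nat \<Rightarrow> (nat \<Rightarrow> nat) \<Rightarrow> (nat \<times> nat) set" where
  "indices K n = (SIGMA k:{1..K}. {..<n k})"

text \<open>As a sparsity pattern this relation expresses block diagonality.\<close>

definition same_user :: "nat \<times> nat \<Rightarrow> nat \<times> nat \<Rightarrow> bool" where
  "same_user x y \<longleftrightarrow> fst x = fst y"

text \<open>All channels in one matrix with \<open>H k j\<close> as block \<open>(k, j)\<close>. The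
  value zero elsewhere is what \<open>generic_on\<close> demands.\<close>

definition joint_channel :: "nat \<Rightarrow> (nat \<Rightarrow> nat) \<Rightarrow> (nat \<Rightarrow> nat) \<Rightarrow> (nat \<Rightarrow> nat \<Rightarrow> complex mat) \<Rightarrow>
    nat \<times> nat \<Rightarrow> nat \<times> nat \<Rightarrow> complex" where
  "joint_channel K M N H y z = (if y \<in> indices K N \<and> z \<in> indices K M
     then H (fst y) (fst z) $$ (snd y, snd z) else 0)"

section \<open>Alignment solutions and block diagonal solutions of the joint equation\<close>

lemma finite_indices: "finite (indices K n)"
  by (simp add: indices_def)

lemma sum_indices_single:
  assumes "k \<in> {1..K}" "\<And>k' i. k' \<noteq> k \<Longrightarrow> F (k', i) = 0"
  shows "sum F (indices K n) = (\<Sum>i<n k. F (k, i))"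
proof -
  have "sum F (indices K n) = sum F ({k} \<times> {..<n k})"
  proof (rule sum.mono_neutral_right)
    show "\<forall>y\<in>indices K n - {k} \<times> {..<n k}. F y = 0"
    proof
      fix y assume y: "y \<in> indices K n - {k} \<times> {..<n k}"
      then have "fst y \<noteq> k" by (auto simp: indices_def)
      then show "F y = 0" using assms(2)[of "fst y" "snd y"] by simp
    qed
  qed (use assms in \<open>auto simp: indices_def\<close>)
  then show ?thesis by (simp add: sum_Times)
qed

lemma index_mat_triple:
  fixes A H V :: "'a::comm_ring_1 mat"
  assumes A: "A \<in> carrier_mat r n" and H: "H \<in> carrier_mat n m" and V: "V \<in> carrier_mat m s"
    and ab: "a < r" "b < s"
  shows "(A * H * V) $$ (a, b) = (\<Sum>i<n. \<Sum>l<m. A $$ (a, i) * H $$ (i, l) * V $$ (l, b))"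
proof -
  have "(A * H * V) $$ (a, b) = (\<Sum>l<m. (\<Sum>i<n. A $$ (a, i) * H $$ (i, l)) * V $$ (l, b))"
    using assms by (simp add: scalar_prod_def lessThan_atLeast0 del: assoc_mult_mat)
  then show ?thesis by (simp add: sum_distrib_right sum.swap[of _ "{..<n}"])
qed

text \<open>Block diagonal factors let row \<open>(k, a)\<close> meet only antennas of receiver
  \<open>k\<close> and column \<open>(j, b)\<close> only antennas of transmitter \<open>j\<close>,
  so the big sum reduces to block \<open>(k, j)\<close>.\<close>

lemma sandwich_joint_channel:
  assumes k: "k \<in> {1..K}" "j \<in> {1..K}" and a: "a < d k" and b: "b < d j"
    and A: "A \<in> carrier_mat (d k) (N k)" and V: "V \<in> carrier_mat (M j) (d j)"
    and H: "H k j \<in> carrier_mat (N k) (M j)"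
    and A': "\<And>k' i. A' (k, a) (k', i) = (if k' = k \<and> i < N k then A $$ (a, i) else 0)"
    and V': "\<And>j' l. V' (j', l) (j, b) = (if j' = j \<and> l < M j then V $$ (l, b) else 0)"
  shows "sandwich (indices K N) (indices K M) A' (joint_channel K M N H) V' (k, a) (j, b) =
    (A * H k j * V) $$ (a, b)"
proof -
  have "sandwich (indices K N) (indices K M) A' (joint_channel K M N H) V' (k, a) (j, b) =
    (\<Sum>i<N k. \<Sum>z\<in>indices K M. A' (k, a) (k, i) * joint_channel K M N H (k, i) z * V' z (j, b))"
    unfolding sandwich_def by (rule sum_indices_single[OF k(1)]) (simp add: A')
  also have "\<dots> = (\<Sum>i<N k. \<Sum>l<M j. A' (k, a) (k, i) * joint_channel K M N H (k, i) (j, l) * V' (j, l) (j, b))"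
    by (intro sum.cong refl sum_indices_single[OF k(2)]) (simp add: V')
  also have "\<dots> = (\<Sum>i<N k. \<Sum>l<M j. A $$ (a, i) * H k j $$ (i, l) * V $$ (l, b))"
    using k by (intro sum.cong refl) (simp add: A' V' joint_channel_def indices_def)
  also have "\<dots> = (A * H k j * V) $$ (a, b)"
    by (rule index_mat_triple[OF A H V a b, symmetric])
  finally show ?thesis .
qed

lemma mat_adjoint_carrier:
  "A \<in> carrier_mat n m \<Longrightarrow> mat_adjoint A \<in> carrier_mat m n"
  by (auto simp: mat_adjoint_def mat_of_rows_def)

lemma mat_adjoint_adjoint:
  "mat_adjoint (mat_adjoint A) = (A :: 'a::conjugatable_field mat)"
  by (rule eq_matI) (auto simp: mat_adjoint_def mat_of_rows_def)

text \<open>Replacing the adjoint of \<open>U\<^sub>k\<close> by its product with the inverse of \<open>U\<^sub>k\<^sup>H H\<^sub>k\<^sub>k V\<^sub>k\<close> turns the rank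
  condition into an equation.\<close>

lemma ia_solution_imp_solves:
  assumes H: "\<And>k j. k \<in> {1..K} \<Longrightarrow> j \<in> {1..K} \<Longrightarrow> H k j \<in> carrier_mat (N k) (M j)"
    and sol: "ia_solution K M N d H U V"
  obtains A' V' where
    "solves (indices K d) (indices K N) (indices K M) same_user same_user (joint_channel K M N H) A' V'"
proof -
  have U: "mat_adjoint (U k) \<in> carrier_mat (d k) (N k)" and V: "V k \<in> carrier_mat (M k) (d k)"
    if "k \<in> {1..K}" for k using sol that by (auto simp: ia_solution_def intro: mat_adjoint_carrier)
  have "\<exists>C. C \<in> carrier_mat (d k) (d k) \<and> C * (mat_adjoint (U k) * H k k * V k) = 1\<^sub>m (d k)"
    if k: "k \<in> {1..K}" for k
  proof -
    let ?B = "mat_adjoint (U k) * H k k * V k"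
    have B: "?B \<in> carrier_mat (d k) (d k)" using U[OF k] V[OF k] H[OF k k] by auto
    have "vec_space.rank (d k) ?B = d k" using sol k by (simp add: ia_solution_def)
    then have "det ?B \<noteq> 0" using vec_space.det_rank_iff[OF B] by simp
    from det_non_zero_imp_unit[OF B this, of "()"] show ?thesis
      by (auto simp: Units_def ring_mat_def)
  qed
  then obtain C where C: "\<And>k. k \<in> {1..K} \<Longrightarrow> C k \<in> carrier_mat (d k) (d k)"
    "\<And>k. k \<in> {1..K} \<Longrightarrow> C k * (mat_adjoint (U k) * H k k * V k) = 1\<^sub>m (d k)" by metis
  define A where "A k = C k * mat_adjoint (U k)" for k
  have A: "A k \<in> carrier_mat (d k) (N k)" if "k \<in> {1..K}" for k
    using C(1)[OF that] U[OF that] by (simp add: A_def)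
  have AHV: "A k * H k j * V j = (if k = j then 1\<^sub>m (d k) else 0\<^sub>m (d k) (d j))"
    if kj: "k \<in> {1..K}" "j \<in> {1..K}" for k j
  proof -
    have UH: "mat_adjoint (U k) * H k j \<in> carrier_mat (d k) (M j)" using U[OF kj(1)] H[OF kj] by simp
    have "A k * H k j * V j = C k * (mat_adjoint (U k) * H k j) * V j"
      using C(1)[OF kj(1)] U[OF kj(1)] H[OF kj] by (simp add: A_def assoc_mult_mat)
    also have "\<dots> = C k * (mat_adjoint (U k) * H k j * V j)"
      using C(1)[OF kj(1)] UH V[OF kj(2)] by (rule assoc_mult_mat)
    also have "\<dots> = (if k = j then 1\<^sub>m (d k) else 0\<^sub>m (d k) (d j))"
      using C[OF kj(1)] sol kj by (auto simp: ia_solution_def)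
    finally show ?thesis .
  qed
  define A' where "A' x y = (if same_user x y \<and> snd y < N (fst x) then A (fst x) $$ (snd x, snd y) else 0)"
    for x y
  define V' where "V' z x = (if same_user z x \<and> snd z < M (fst x) then V (fst x) $$ (snd z, snd x) else 0)"
    for z x
  have "sandwich (indices K N) (indices K M) A' (joint_channel K M N H) V' x x' = (if x = x' then 1 else 0)"
    if "x \<in> indices K d" "x' \<in> indices K d" for x x'
  proof -
    obtain k a j b where x: "x = (k, a)" "x' = (j, b)" by (cases x, cases x')
    then have kj: "k \<in> {1..K}" "j \<in> {1..K}" and ab: "a < d k" "b < d j"
      using that by (auto simp: indices_def)
    have "sandwich (indices K N) (indices K M) A' (joint_channel K M N H) V' x x' =
      (A k * H k j * V j) $$ (a, b)"
      unfolding x by (rule sandwich_joint_channel[where d = d and N = N and M = M and H = H, OF kj ab A[OF kj(1)] V[OF kj(2)] H[OF kj]])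
        (auto simp: A'_def V'_def same_user_def)
    then show ?thesis using AHV[OF kj] ab by (auto simp: x)
  qed
  moreover have "supported same_user A'" "supported same_user V'"
    by (auto simp: supported_def A'_def V'_def)
  ultimately show ?thesis by (intro that[of A' V']) (simp add: solves_def)
qed

text \<open>The diagonal blocks of the product are identity matrices and thus of full rank; the
  adjoint of the block \<open>A k\<close> serves as \<open>U k\<close>.\<close>

lemma solves_imp_ia_solution:
  assumes H: "\<And>k j. k \<in> {1..K} \<Longrightarrow> j \<in> {1..K} \<Longrightarrow> H k j \<in> carrier_mat (N k) (M j)"
    and sol: "solves (indices K d) (indices K N) (indices K M) same_user same_user (joint_channel K M N H) A' V'"
  shows "\<exists>U V. ia_solution K M N d H U V"
proof -
  define A where "A k = mat (d k) (N k) (\<lambda>(a, i). A' (k, a) (k, i))" for k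
  define V where "V k = mat (M k) (d k) (\<lambda>(l, b). V' (k, l) (k, b))" for k
  \<comment> \<open>\<open>same_user\<close> does not bound positions inside a block, whereas
    \<open>sandwich_joint_channel\<close> wants zeros beyond the block size; the sums over
    \<open>indices\<close> do not see the difference.\<close>
  define A0 where "A0 x y = (if snd y < N (fst x) then A' x y else 0)" for x y
  define V0 where "V0 z x = (if snd z < M (fst x) then V' z x else 0)" for z x
  have A: "A k \<in> carrier_mat (d k) (N k)" and V: "V k \<in> carrier_mat (M k) (d k)" for k
    by (simp_all add: A_def V_def)
  have zero: "fst x \<noteq> fst y \<Longrightarrow> A' x y = 0" "fst z \<noteq> fst x \<Longrightarrow> V' z x = 0" for x y z
    using sol unfolding solves_def supported_def same_user_def by blast+
  have AHV: "A k * H k j * V j = (if k = j then 1\<^sub>m (d k) else 0\<^sub>m (d k) (d j))"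
    if kj: "k \<in> {1..K}" "j \<in> {1..K}" for k j
  proof (rule eq_matI)
    fix a b assume "a < dim_row (if k = j then 1\<^sub>m (d k) else 0\<^sub>m (d k) (d j) :: complex mat)"
      "b < dim_col (if k = j then 1\<^sub>m (d k) else 0\<^sub>m (d k) (d j) :: complex mat)"
    then have ab: "a < d k" "b < d j" by (auto split: if_splits)
    have "A0 (k, a) y = A' (k, a) y" if "y \<in> indices K N" for y
      using that zero(1)[of "(k, a)" y] by (cases "fst y = k") (auto simp: A0_def indices_def)
    moreover have "V0 z (j, b) = V' z (j, b)" if "z \<in> indices K M" for z
      using that zero(2)[of z "(j, b)"] by (cases "fst z = j") (auto simp: V0_def indices_def)
    ultimately have "sandwich (indices K N) (indices K M) A' (joint_channel K M N H) V' (k, a) (j, b) =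
      sandwich (indices K N) (indices K M) A0 (joint_channel K M N H) V0 (k, a) (j, b)"
      unfolding sandwich_def by (intro sum.cong refl) simp
    also have "\<dots> = (A k * H k j * V j) $$ (a, b)"
      by (rule sandwich_joint_channel[where d = d and N = N and M = M and H = H, OF kj ab A V H[OF kj]])
        (use ab zero in \<open>auto simp: A0_def V0_def A_def V_def\<close>)
    finally show "(A k * H k j * V j) $$ (a, b) = (if k = j then 1\<^sub>m (d k) else 0\<^sub>m (d k) (d j)) $$ (a, b)"
      using sol kj ab by (auto simp: solves_def indices_def)
  qed (use A[of k] V[of j] in auto)
  have "ia_solution K M N d H (\<lambda>k. mat_adjoint (A k)) V"
    unfolding ia_solution_def mat_adjoint_adjoint
  proof (intro conjI ballI impI)
    fix k assume k: "k \<in> {1..K}"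
    show "mat_adjoint (A k) \<in> carrier_mat (N k) (d k)" "V k \<in> carrier_mat (M k) (d k)"
      using A V by (auto intro: mat_adjoint_carrier)
    have "det (1\<^sub>m (d k) :: complex mat) \<noteq> 0" by simp
    then show "vec_space.rank (d k) (A k * H k k * V k) = d k"
      using vec_space.det_rank_iff[of "1\<^sub>m (d k) :: complex mat" "d k"] AHV[OF k k] by simp
  qed (use AHV in auto)
  then show ?thesis by blast
qed

section \<open>Generic channels and the enlarged network\<close>

lemma (in mimo_network) AE_generic_joint_channel:
  "AE \<omega> in P. generic_on (indices K N \<times> indices K M)
     (\<lambda>(y, z). joint_channel K M N (\<lambda>k j. H k j \<omega>) y z)"
proof -
  define g :: "(nat \<times> nat) \<times> (nat \<times> nat) \<Rightarrow> nat \<times> nat \<times> nat \<times> nat"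
    where "g = (\<lambda>((k, i), (j, l)). (k, j, i, l))"
  have g: "bij g"
    by (rule bij_betw_byWitness[where f' = "\<lambda>(k, j, i, l). ((k, i), (j, l))"]) (auto simp: g_def)
  let ?I = "channel_entries K M N"
  define X where "X = (\<lambda>(k, j, a, b) \<omega>. H k j \<omega> $$ (a, b))"
  have gI: "g -` ?I = indices K N \<times> indices K M"
    by (auto simp: g_def channel_entries_def indices_def)
  have "finite (g -` ?I)" unfolding gI by (simp add: finite_indices)
  then have "finite ?I" using g by (metis bij_is_surj finite_imageI surj_image_vimage_eq)
  moreover have "(1, 1, 0, 0) \<in> ?I" using config by (auto simp: configuration_def channel_entries_def)
  ultimately have "AE \<omega> in P. generic_on ?I (\<lambda>v. if v \<in> ?I then X v \<omega> else 0)"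
    using channel_indep channel_continuous by (intro AE_generic_on) (auto simp: X_def)
  then show ?thesis
  proof eventually_elim
    case (elim \<omega>)
    have "(\<lambda>v. if g v \<in> ?I then X (g v) \<omega> else 0) = (\<lambda>(y, z). joint_channel K M N (\<lambda>k j. H k j \<omega>) y z)"
      by (auto simp: fun_eq_iff joint_channel_def X_def g_def channel_entries_def indices_def)
    then show ?case using generic_on_reindex[OF elim g] by (simp add: gI)
  qed
qed

text \<open>Position \<open>p * n k + i\<close> in the enlarged block of user \<open>k\<close> is
  position \<open>i\<close> of copy \<open>p\<close>. The user is kept, which carries the pattern
  \<open>same_user\<close> over to the large format.\<close>

definition split_index :: "(nat \<Rightarrow> nat) \<Rightarrow> nat \<times> nat \<Rightarrow> (nat \<times> nat) \<times> nat" where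
  "split_index n x = ((fst x, snd x mod n (fst x)), snd x div n (fst x))"

lemma bij_betw_split_index:
  assumes "\<And>k. k \<in> {1..K} \<Longrightarrow> 0 < n k"
  shows "bij_betw (split_index n) (indices K (\<lambda>k. c * n k)) (indices K n \<times> {..<c})"
proof -
  define join where "join = (\<lambda>((k, i), p). (k, p * n k + i))"
  have join: "join ((k, i), p) = (k, p * n k + i)" for k i p by (simp add: join_def)
  show ?thesis
  proof (rule bij_betw_byWitness[where f' = join])
    show "\<forall>x\<in>indices K (\<lambda>k. c * n k). join (split_index n x) = x"
      by (auto simp: split_index_def join)
    show "\<forall>x\<in>indices K n \<times> {..<c}. split_index n (join x) = x"
      by (auto simp: split_index_def indices_def join)
    show "split_index n ` indices K (\<lambda>k. c * n k) \<subseteq> indices K n \<times> {..<c}"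
      using assms by (auto simp: split_index_def indices_def less_mult_imp_div_less)
    show "join ` (indices K n \<times> {..<c}) \<subseteq> indices K (\<lambda>k. c * n k)"
    proof -
      have "p * m + i < c * m" if "p < c" "i < m" for p m i :: nat
      proof -
        have "p * m + i < Suc p * m" using that by simp
        also have "\<dots> \<le> c * m" using that by (intro mult_le_mono1) simp
        finally show ?thesis .
      qed
      then show ?thesis by (auto simp: indices_def join)
    qed
  qed
qed

theorem mainTheorem4:
  fixes P :: "'w measure" and P' :: "'v measure"
    and K c :: nat and M N d :: "nat \<Rightarrow> nat"
    and H :: "nat \<Rightarrow> nat \<Rightarrow> 'w \<Rightarrow> complex mat"
    and H' :: "nat \<Rightarrow> nat \<Rightarrow> 'v \<Rightarrow> complex mat"
  assumes "mimo_network P K M N d H"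
    and "ia_feasible P K M N d H"
    and "0 < c"
    and "mimo_network P' K (\<lambda>k. c * M k) (\<lambda>k. c * N k) (\<lambda>k. c * d k) H'"
  shows "ia_feasible P' K (\<lambda>k. c * M k) (\<lambda>k. c * N k) (\<lambda>k. c * d k) H'"
proof -
  interpret net: mimo_network P K M N d H by fact
  interpret net': mimo_network P' K "\<lambda>k. c * M k" "\<lambda>k. c * N k" "\<lambda>k. c * d k" H' by fact
  let ?N' = "\<lambda>k. c * N k" and ?M' = "\<lambda>k. c * M k" and ?d' = "\<lambda>k. c * d k"
  have pos: "\<And>k. k \<in> {1..K} \<Longrightarrow> 0 < M k" "\<And>k. k \<in> {1..K} \<Longrightarrow> 0 < N k" "\<And>k. k \<in> {1..K} \<Longrightarrow> 0 < d k"
    using net.config by (auto simp: configuration_def)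
  \<comment> \<open>Two almost sure events meet: one sample point with a solution and generic
    channels is all that is taken from the small network.\<close>
  have "AE \<omega> in P. \<omega> \<in> space P \<and> (\<exists>U V. ia_solution K M N d (\<lambda>k j. H k j \<omega>) U V) \<and>
    generic_on (indices K N \<times> indices K M) (\<lambda>(y, z). joint_channel K M N (\<lambda>k j. H k j \<omega>) y z)"
    using assms(2) net.AE_generic_joint_channel AE_space unfolding ia_feasible_def
    by eventually_elim blast
  then obtain \<omega> U V where \<omega>: "\<omega> \<in> space P" and sol: "ia_solution K M N d (\<lambda>k j. H k j \<omega>) U V" and
    gen: "generic_on (indices K N \<times> indices K M) (\<lambda>(y, z). joint_channel K M N (\<lambda>k j. H k j \<omega>) y z)"
    using eventually_happens'[of "ae_filter P"] net.ae_filter_bot by blast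
  let ?h = "joint_channel K M N (\<lambda>k j. H k j \<omega>)"
  obtain A V where AV: "solves (indices K d) (indices K N) (indices K M) same_user same_user ?h A V"
    by (rule ia_solution_imp_solves[OF net.channel_dim[OF _ _ \<omega>] sol])
  have "tangent_surj (indices K d) (indices K N) (indices K M) same_user same_user ?h A V"
    using finite_indices finite_indices finite_indices gen AV by (rule generic_tangent_surj)
  then obtain h0 :: "nat \<times> nat \<Rightarrow> nat \<times> nat \<Rightarrow> complex" and A0 V0 where 0:
    "solves (indices K ?d') (indices K ?N') (indices K ?M') same_user same_user h0 A0 V0"
    "tangent_surj (indices K ?d') (indices K ?N') (indices K ?M') same_user same_user h0 A0 V0"
    using tangent_surj_blocks[OF AV _ finite_lessThan[of c]
        bij_betw_imp_inj_on[OF bij_betw_split_index[OF pos(3)]]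
        equalityD1[OF bij_betw_imp_surj_on[OF bij_betw_split_index[OF pos(3)]]]
        bij_betw_split_index[OF pos(2)] bij_betw_split_index[OF pos(1)], of same_user same_user]
    by (auto simp: same_user_def split_index_def)
  \<comment> \<open>The solution \<open>A0\<close>, \<open>V0\<close> for the fixed
    \<open>h0\<close> has a surjective tangent map and so transfers to every generic channel of the
    large network, hence to almost every sample point.\<close>
  have "AE \<omega> in P'. \<omega> \<in> space P' \<and> generic_on (indices K ?N' \<times> indices K ?M')
    (\<lambda>(y, z). joint_channel K ?M' ?N' (\<lambda>k j. H' k j \<omega>) y z)"
    using net'.AE_generic_joint_channel AE_space by eventually_elim blast
  then show ?thesis unfolding ia_feasible_def
  proof eventually_elim
    case (elim \<omega>)
    then obtain A V where "solves (indices K ?d') (indices K ?N') (indices K ?M') same_user same_user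
        (joint_channel K ?M' ?N' (\<lambda>k j. H' k j \<omega>)) A V"
      using generic_solution[OF finite_indices finite_indices finite_indices 0] by metis
    then show ?case
      by (intro solves_imp_ia_solution) (use net'.channel_dim elim in auto)
  qed
qed

end
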